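(* For a binary sequence $X_1,X_2,\dots$ and $t\ge1$ define $$R_t:=\frac{\Gamma\left(n_{0|0}+\tfrac12\right)\Gamma\left(n_{0|1}+\tfrac12\right)\Gamma\left(n_{1|0}+\tfrac12\right)\Gamma\left(n_{1|1}+\tfrac12\right)}{2\,\Gamma\left(\tfrac12\right)^4\,\Gamma(n_{0|0}+n_{1|0}+1)\,\Gamma(n_{0|1}+n_{1|1}+1)}\Big/\left(\left(\frac{n_1}{t}\right)^{n_1}\left(\frac{n_0}{t}\right)^{n_0}\right),$$ and $R_0:=1$. Then $(R_t)_{t\ge0}$ is a $\mathcal{Q}$-safe e-process for $\mathcal{Q}=\{\mathrm{Ber}(p)^\infty:p\in[0,1]\}$, and thus thresholding it at level $1/\alpha$ yields a level $\alpha$ sequential test for exchangeability: for every $\alpha\in(0,1)$, with $\kappa_\alpha:=\inf\{t\ge1:R_t\ge1/\alpha\}$, one has $\sup_{\mathtt{Q}\in\overline{\mathcal{Q}}}\mathtt{Q}(\kappa_\alpha<\infty)\le\alpha$.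
   Context: The data $(X_t)_{t\ge1}$ are the coordinates on $\{0,1\}^{\mathbb{N}}$; $\mathcal{F}_0$ is trivial and $\mathcal{F}_t=\sigma(X_1,\dots,X_t)$. $\Gamma$ is the gamma function. $n_0=n_0(t)$ and $n_1=n_1(t)$ are the numbers of zeros and ones among $X_1,\dots,X_t$; $n_{j|i}=n_{j|i}(t)$ is the number of $s\in\{2,\dots,t\}$ with $X_{s-1}=i$ and $X_s=j$ (e.g. $n_{1|0}$ counts ones following zeros). Convention: $0^0:=1$. A $\mathcal{Q}$-safe e-process is a nonnegative adapted process $(E_t)_{t\ge0}$ with $\sup_{\mathtt{Q}\in\mathcal{Q}}\sup_\tau\mathbb{E}_{\mathtt{Q}}[E_\tau]\le1$, where $\tau$ ranges over all, possibly infinite, $(\mathcal{F}_t)$-stopping times and $E_\infty:=\limsup_{t\to\infty}E_t$. $\overline{\mathcal{Q}}$ is the set of all exchangeable laws on $\{0,1\}^{\mathbb{N}}$, i.e. those for which $(X_1,\dots,X_t)$ and $(X_{\sigma(1)},\dots,X_{\sigma(t)})$ have the same law for every $t$ and every permutation $\sigma$ of $\{1,\dots,t\}$. *)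

theory Defs
  imports "HOL-Probability.Probability" "HOL-Combinatorics.Permutations"
begin

text \<open>Binary outcomes are booleans, with \<^const>\<open>True\<close> for 1 and \<^const>\<open>False\<close> for 0. Time starts at 1,
  so the sequence space is the product over the index set \<open>{1..}\<close>, whose points are extensional functions.\<close>

definition seq_space :: "(nat \<Rightarrow> bool) measure" where
  "seq_space = PiM {1..} (\<lambda>_. count_space UNIV)"

definition X :: "nat \<Rightarrow> (nat \<Rightarrow> bool) \<Rightarrow> bool" where
  "X t \<omega> = \<omega> t"

text \<open>The filtration is indexed by \<^typ>\<open>enat\<close>, so that \<open>stopping_time \<F>\<close> describes possibly infinite
  stopping times: at index \<open>\<infinity>\<close> the condition of \<^const>\<open>stopping_time\<close> holds trivially.\<close>

definition \<F> :: "enat \<Rightarrow> (nat \<Rightarrow> bool) measure" where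
  "\<F> t = sigma (space seq_space)
     {X s -` A \<inter> space seq_space | s A. 1 \<le> s \<and> enat s \<le> t}"

definition value_at ::
  "(nat \<Rightarrow> (nat \<Rightarrow> bool) \<Rightarrow> real) \<Rightarrow> ((nat \<Rightarrow> bool) \<Rightarrow> enat) \<Rightarrow> (nat \<Rightarrow> bool) \<Rightarrow> ennreal" where
  "value_at E \<tau> \<omega> = (case \<tau> \<omega> of
       enat t \<Rightarrow> ennreal (E t \<omega>)
     | \<infinity> \<Rightarrow> limsup (\<lambda>t. ennreal (E t \<omega>)))"

definition safe_e_process ::
  "(nat \<Rightarrow> bool) measure set \<Rightarrow> (nat \<Rightarrow> (nat \<Rightarrow> bool) \<Rightarrow> real) \<Rightarrow> bool" where
  "safe_e_process \<Q> E \<longleftrightarrow>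
     (\<forall>t. \<forall>\<omega>\<in>space seq_space. 0 \<le> E t \<omega>) \<and>
     (\<forall>t. E t \<in> borel_measurable (\<F> (enat t))) \<and>
     (SUP Q\<in>\<Q>. SUP \<tau>\<in>{\<tau>. stopping_time \<F> \<tau>}. \<integral>\<^sup>+ \<omega>. value_at E \<tau> \<omega> \<partial>Q) \<le> 1"

definition bernoulli_law :: "real \<Rightarrow> (nat \<Rightarrow> bool) measure" where
  "bernoulli_law p = PiM {1..} (\<lambda>_. measure_pmf (bernoulli_pmf p))"

definition exchangeable_laws :: "(nat \<Rightarrow> bool) measure set" where
  "exchangeable_laws = {Q. prob_space Q \<and> sets Q = sets seq_space \<and>
     (\<forall>t \<sigma>. \<sigma> permutes {1..t} \<longrightarrow>
        distr Q (PiM {1..t} (\<lambda>_. count_space UNIV)) (\<lambda>\<omega>. \<lambda>s\<in>{1..t}. X s \<omega>) =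
        distr Q (PiM {1..t} (\<lambda>_. count_space UNIV)) (\<lambda>\<omega>. \<lambda>s\<in>{1..t}. X (\<sigma> s) \<omega>))}"

definition num :: "bool \<Rightarrow> nat \<Rightarrow> (nat \<Rightarrow> bool) \<Rightarrow> nat" where
  "num j t \<omega> = card {s\<in>{1..t}. X s \<omega> = j}"

text \<open>\<open>trans_count j i\<close> is $n_{j|i}$: the new symbol comes first, the preceding one second.\<close>

definition trans_count :: "bool \<Rightarrow> bool \<Rightarrow> nat \<Rightarrow> (nat \<Rightarrow> bool) \<Rightarrow> nat" where
  "trans_count j i t \<omega> = card {s\<in>{2..t}. X (s - 1) \<omega> = i \<and> X s \<omega> = j}"

definition R :: "nat \<Rightarrow> (nat \<Rightarrow> bool) \<Rightarrow> real" where
  "R t \<omega> = (if t = 0 then 1 else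
     let n0 = num False t \<omega>; n1 = num True t \<omega>;
         n00 = trans_count False False t \<omega>; n01 = trans_count False True t \<omega>;
         n10 = trans_count True False t \<omega>; n11 = trans_count True True t \<omega>
     in (Gamma (real n00 + 1/2) * Gamma (real n01 + 1/2) *
           Gamma (real n10 + 1/2) * Gamma (real n11 + 1/2) /
         (2 * Gamma (1/2) ^ 4 * Gamma (real n00 + real n10 + 1) * Gamma (real n01 + real n11 + 1))) /
        ((real n1 / real t) ^ n1 * (real n0 / real t) ^ n0))"

definition \<kappa> :: "real \<Rightarrow> (nat \<Rightarrow> bool) \<Rightarrow> enat" where
  "\<kappa> \<alpha> \<omega> = Inf {enat t | t. 1 \<le> t \<and> R t \<omega> \<ge> 1 / \<alpha>}"

end

theory Submission
  imports Defs
begin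

text \<open>The numerator of \<open>R\<close> is the Krichevsky-Trofimov mixture probability \<open>kt\<close> of a first-order
  Markov model, and the denominator is the maximum of the Bernoulli likelihoods \<open>lik p\<close>. Hence \<open>R\<close>
  is dominated almost surely under each Bernoulli law by the likelihood ratio \<open>kt / lik p\<close>, a
  nonnegative supermartingale. Infinite stopping times require its almost sure convergence, which
  Dubins' upcrossing inequality provides; Fatou's lemma then bounds the expected limit superior of
  the stopped process. For the exchangeable laws, de Finetti's theorem is replaced by a comparison
  of sampling without and with replacement from the first \<open>N\<close> symbols: an event determined by time
  \<open>T\<close> has at most \<open>(N / (N - T)) ^ T\<close> times the probability it has under a mixture of Bernoulli
  laws, and \<open>N\<close> tends to infinity.\<close>

section \<open>Nonnegative supermartingales with values in \<open>ennreal\<close>\<close>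

text \<open>Testing against every nonnegative \<open>H\<close> known at time \<open>n\<close> states
  the supermartingale inequality without forming conditional expectations, so \<open>M\<close> may
  take infinite values.\<close>

locale nonneg_supermartingale = prob_space Q for Q :: "'a measure" +
  fixes F :: "nat \<Rightarrow> 'a measure" and M :: "nat \<Rightarrow> 'a \<Rightarrow> ennreal"
  assumes subalg: "subalgebra Q (F n)"
    and sets_mono: "sets (F n) \<subseteq> sets (F (Suc n))"
    and adapted [measurable]: "M n \<in> borel_measurable (F n)"
    and super: "H \<in> borel_measurable (F n) \<Longrightarrow>
      (\<integral>\<^sup>+ \<omega>. H \<omega> * M (Suc n) \<omega> \<partial>Q) \<le> (\<integral>\<^sup>+ \<omega>. H \<omega> * M n \<omega> \<partial>Q)"
begin

lemma measurable_Suc: "f \<in> measurable (F n) N \<Longrightarrow> f \<in> measurable (F (Suc n)) N"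
  by (rule measurable_from_subalg[of _ "F n"])
    (use subalg[of n] subalg[of "Suc n"] sets_mono[of n] in \<open>auto simp: subalgebra_def\<close>)

lemma measurable_Q: "f \<in> measurable (F n) N \<Longrightarrow> f \<in> measurable Q N"
  by (rule measurable_from_subalg[OF subalg])

lemma adapted_Q [measurable]: "M n \<in> borel_measurable Q"
  by (rule measurable_Q) measurable

lemma nn_integral_le: "(\<integral>\<^sup>+ \<omega>. M n \<omega> \<partial>Q) \<le> (\<integral>\<^sup>+ \<omega>. M 0 \<omega> \<partial>Q)"
proof (induction n)
  case (Suc n)
  have "(\<integral>\<^sup>+ \<omega>. M (Suc n) \<omega> \<partial>Q) \<le> (\<integral>\<^sup>+ \<omega>. M n \<omega> \<partial>Q)"
    using super[of "\<lambda>_. 1" n] by simp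
  with Suc show ?case by simp
qed simp

end

section \<open>Counting upcrossings\<close>

text \<open>\<open>crossing a b x n\<close> is the number of completed upcrossings of \<open>[a, b]\<close> by \<open>x\<close> up to time \<open>n\<close>,
  together with a flag telling whether an upcrossing is in progress.\<close>

fun crossing_step :: "ennreal \<Rightarrow> ennreal \<Rightarrow> nat \<times> bool \<Rightarrow> ennreal \<Rightarrow> nat \<times> bool" where
  "crossing_step a b (k, True) m = (if b \<le> m then (Suc k, False) else (k, True))"
| "crossing_step a b (k, False) m = (k, m \<le> a)"

fun crossing :: "ennreal \<Rightarrow> ennreal \<Rightarrow> (nat \<Rightarrow> ennreal) \<Rightarrow> nat \<Rightarrow> nat \<times> bool" where
  "crossing a b x 0 = (0, False)"
| "crossing a b x (Suc n) = crossing_step a b (crossing a b x n) (x (Suc n))"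

lemma fst_crossing_step: "fst s \<le> fst (crossing_step a b s m)"
  by (cases "(a, b, s, m)" rule: crossing_step.cases) auto

text \<open>A low value starts an upcrossing when none is in progress, and a high value completes
  one in progress. Both kinds of value recur for ever, so no state can persist.\<close>

lemma crossing_unbounded:
  assumes low: "\<exists>\<^sub>F n in sequentially. x n \<le> a" and high: "\<exists>\<^sub>F n in sequentially. b \<le> x n"
  shows "\<exists>n. K \<le> fst (crossing a b x n)"
proof -
  \<comment> \<open>\<open>crossing\<close> never reads \<open>x 0\<close>, so the low and high
    times are needed in the form \<open>Suc n\<close>.\<close>
  have low': "\<exists>n\<ge>m. x (Suc n) \<le> a" for m
    using low unfolding frequently_sequentially
    by (metis Suc_le_D Suc_le_mono)
  have high': "\<exists>n\<ge>m. b \<le> x (Suc n)" for m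
    using high unfolding frequently_sequentially
    by (metis Suc_le_D Suc_le_mono)
  have down_up: "\<exists>n. crossing a b x n = (k, True)" if "crossing a b x m = (k, False)" for m k
  proof (rule ccontr)
    assume not: "\<nexists>n. crossing a b x n = (k, True)"
    have stay: "crossing a b x n = (k, False)" if "m \<le> n" for n
      using that
    proof (induction n rule: dec_induct)
      case (step n)
      then show ?case using not by (metis crossing.simps(2) crossing_step.simps(2))
    qed fact
    from low' obtain n where "n \<ge> m" "x (Suc n) \<le> a" by blast
    then show False using stay[of n] not by (metis crossing.simps(2) crossing_step.simps(2))
  qed
  have up_down: "\<exists>n. crossing a b x n = (Suc k, False)" if "crossing a b x m = (k, True)" for m k
  proof (rule ccontr)
    assume not: "\<nexists>n. crossing a b x n = (Suc k, False)"
    have stay: "crossing a b x n = (k, True)" if "m \<le> n" for n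
      using that
    proof (induction n rule: dec_induct)
      case (step n)
      then show ?case using not by (metis crossing.simps(2) crossing_step.simps(1))
    qed fact
    from high' obtain n where "n \<ge> m" "b \<le> x (Suc n)" by blast
    then show False using stay[of n] not by (metis crossing.simps(2) crossing_step.simps(1))
  qed
  have "\<exists>n. crossing a b x n = (K, False)"
  proof (induction K)
    case 0
    show ?case by (rule exI[of _ 0]) simp
  next
    case (Suc K)
    then show ?case using down_up up_down by blast
  qed
  then show ?thesis by (metis fst_conv le_refl)
qed

text \<open>Rational endpoints make the exceptional null sets a countable family; \<open>a\<close>
  must be positive for Dubins' inequality.\<close>

lemma ennreal_between_rats:
  fixes x y :: ennreal
  assumes "x < y"
  obtains a b :: rat where "0 < a" "a < b" "x < ennreal (of_rat a)" "ennreal (of_rat b) < y"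
proof -
  obtain u where u: "x < u" "u < y" using assms dense by blast
  obtain r where r: "u = ennreal r" "0 < r"
    using u by (cases u) (auto simp: not_less_zero zero_less_iff_neq_zero dest: le_less_trans[OF zero_le])
  obtain v where v: "u < v" "v < y" using u dense by blast
  obtain s where s: "v = ennreal s" "r < s"
    using v r by (cases v) (auto simp: ennreal_less_iff)
  obtain m where m: "r < m" "m < s" using s(2) dense by blast
  obtain a where a: "r < real_of_rat a" "real_of_rat a < m" using of_rat_dense[OF m(1)] by blast
  obtain b where b: "m < real_of_rat b" "real_of_rat b < s" using of_rat_dense[OF m(2)] by blast
  show thesis
  proof (rule that[of a b])
    show "0 < a" using a r by (metis order.strict_trans zero_less_of_rat_iff)
    show "a < b" using a b by (metis order.strict_trans of_rat_less)
    show "x < ennreal (of_rat a)"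
      using u(1) a(1) r by (metis ennreal_lessI order.strict_trans)
    show "ennreal (of_rat b) < y"
      using v(2) b(2) s r by (metis ennreal_lessI order.strict_trans)
  qed
qed

section \<open>Dubins' inequality and almost sure convergence\<close>

context nonneg_supermartingale
begin

lemma crossing_measurable:
  "(\<lambda>\<omega>. crossing a b (\<lambda>n. M n \<omega>) n) \<in> measurable (F n) (count_space UNIV)"
proof (induction n)
  case (Suc n)
  note [measurable] = measurable_Suc[OF Suc]
  have "(\<lambda>\<omega>. crossing_step a b s (M (Suc n) \<omega>)) \<in> measurable (F (Suc n)) (count_space UNIV)" for s
  proof (cases s)
    case (Pair k u)
    then show ?thesis by (cases u) simp_all
  qed
  from measurable_compose_countable[where f="\<lambda>s \<omega>. crossing_step a b s (M (Suc n) \<omega>)", OF this measurable_Suc[OF Suc]]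
  show ?case by simp
qed simp

text \<open>The process \<open>Y\<close> below, which buys at \<open>a\<close> and reinvests everything
  at \<open>b\<close>, is again a supermartingale.\<close>

lemma Dubins_inequality:
  fixes a b :: real
  assumes "0 < a" "a < b"
  shows "emeasure Q {\<omega>\<in>space Q. \<exists>n. K \<le> fst (crossing a b (\<lambda>n. M n \<omega>) n)} \<le> ennreal ((a / b) ^ K)"
proof -
  define S where "S n \<omega> = crossing a b (\<lambda>n. M n \<omega>) n" for n \<omega>
  define c where "c = ennreal (b / a)"
  \<comment> \<open>\<open>H\<close> counts the units held and \<open>G\<close> the cash, starting
    from cash 1. After \<open>k\<close> completed upcrossings the capital is \<open>c ^ k\<close>,
    which buys \<open>c ^ k / a\<close> units at price \<open>a\<close>; trading ends at capital
    \<open>c ^ K\<close>.\<close>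
  define H where "H n \<omega> = (if snd (S n \<omega>) \<and> fst (S n \<omega>) < K
    then c ^ fst (S n \<omega>) * ennreal (1 / a) else 0)" for n \<omega>
  define G where "G n \<omega> = (if snd (S n \<omega>) \<and> fst (S n \<omega>) < K
    then 0 else c ^ min K (fst (S n \<omega>)))" for n \<omega>
  define Y where "Y n \<omega> = H n \<omega> * M n \<omega> + G n \<omega>" for n \<omega>
  have S [measurable]: "S n \<in> measurable (F n) (count_space UNIV)" for n
    unfolding S_def by (rule crossing_measurable)
  have SQ [measurable]: "S n \<in> measurable Q (count_space UNIV)" for n
    by (rule measurable_Q[OF S])
  have H: "H n \<in> borel_measurable (F n)" and G: "G n \<in> borel_measurable (F n)" for n
    unfolding H_def G_def by (rule measurable_compose[OF S], simp)+
  note [measurable] = H[THEN measurable_Q] G[THEN measurable_Q]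
  have c1: "1 \<le> c" using assms by (simp add: c_def)
  \<comment> \<open>Rebalancing never gains: a purchase happens only at a price of at most
    \<open>a\<close>, and a sale, at a price of at least \<open>b\<close>, keeps only
    \<open>c ^ Suc k\<close> and discards the surplus.\<close>
  have step: "Y (Suc n) \<omega> \<le> H n \<omega> * M (Suc n) \<omega> + G n \<omega>" for n \<omega>
  proof -
    obtain k u where s: "S n \<omega> = (k, u)" by force
    then have s': "S (Suc n) \<omega> = crossing_step a b (k, u) (M (Suc n) \<omega>)"
      by (simp add: S_def)
    show ?thesis
    proof (cases u)
      case True
      have "c ^ Suc k \<le> c ^ k * ennreal (1 / a) * M (Suc n) \<omega>" if "b \<le> M (Suc n) \<omega>"
      proof -
        have "c = ennreal (1 / a) * b" using assms by (simp add: c_def ennreal_mult[symmetric])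
        also have "\<dots> \<le> ennreal (1 / a) * M (Suc n) \<omega>" by (intro mult_left_mono that) simp
        finally show ?thesis by (simp add: mult.assoc mult.commute[of c] mult_left_mono)
      qed
      then show ?thesis using s s' True by (auto simp: Y_def H_def G_def)
    next
      case False
      have "c ^ k * ennreal (1 / a) * M (Suc n) \<omega> \<le> c ^ k" if "M (Suc n) \<omega> \<le> a"
      proof -
        have "ennreal (1 / a) * M (Suc n) \<omega> \<le> ennreal (1 / a) * a" by (intro mult_left_mono that) simp
        also have "\<dots> = 1" using assms by (simp add: ennreal_mult[symmetric])
        finally have "c ^ k * (ennreal (1 / a) * M (Suc n) \<omega>) \<le> c ^ k * 1" by (rule mult_left_mono) simp
        then show ?thesis by (simp add: mult.assoc)
      qed
      then show ?thesis using s s' False by (auto simp: Y_def H_def G_def)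
    qed
  qed
  have Y: "(\<integral>\<^sup>+\<omega>. Y n \<omega> \<partial>Q) \<le> 1" for n
  proof (induction n)
    case 0
    show ?case by (simp add: Y_def H_def G_def S_def emeasure_space_1)
  next
    case (Suc n)
    have "(\<integral>\<^sup>+\<omega>. Y (Suc n) \<omega> \<partial>Q) \<le> (\<integral>\<^sup>+\<omega>. H n \<omega> * M (Suc n) \<omega> + G n \<omega> \<partial>Q)"
      by (intro nn_integral_mono step)
    also have "\<dots> = (\<integral>\<^sup>+\<omega>. H n \<omega> * M (Suc n) \<omega> \<partial>Q) + (\<integral>\<^sup>+\<omega>. G n \<omega> \<partial>Q)"
      by (intro nn_integral_add) measurable
    also have "\<dots> \<le> (\<integral>\<^sup>+\<omega>. H n \<omega> * M n \<omega> \<partial>Q) + (\<integral>\<^sup>+\<omega>. G n \<omega> \<partial>Q)"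
      by (intro add_right_mono super H)
    also have "\<dots> = (\<integral>\<^sup>+\<omega>. Y n \<omega> \<partial>Q)"
      unfolding Y_def by (intro nn_integral_add[symmetric]) measurable
    finally show ?case using Suc by simp
  qed
  define A where "A n = {\<omega>\<in>space Q. K \<le> fst (S n \<omega>)}" for n
  have [measurable]: "A n \<in> sets Q" for n
    unfolding A_def by measurable
  have "emeasure Q (A n) \<le> ennreal ((a / b) ^ K)" for n
  proof -
    have "c ^ K * emeasure Q (A n) = (\<integral>\<^sup>+\<omega>. c ^ K * indicator (A n) \<omega> \<partial>Q)"
      by (simp add: nn_integral_cmult_indicator)
    also have "\<dots> \<le> (\<integral>\<^sup>+\<omega>. Y n \<omega> \<partial>Q)"
      by (intro nn_integral_mono) (auto simp: A_def Y_def G_def H_def split: split_indicator)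
    finally have le: "c ^ K * emeasure Q (A n) \<le> 1" using Y[of n] by simp
    have "(a / b) ^ K * (b / a) ^ K = 1"
      using assms by (simp add: power_mult_distrib[symmetric])
    then have "ennreal ((a / b) ^ K) * c ^ K = 1"
      using assms by (simp add: c_def ennreal_power ennreal_mult[symmetric])
    then have "emeasure Q (A n) = ennreal ((a / b) ^ K) * (c ^ K * emeasure Q (A n))"
      by (simp add: mult.assoc[symmetric])
    also have "\<dots> \<le> ennreal ((a / b) ^ K) * 1"
      by (intro mult_left_mono le) simp
    finally show ?thesis by simp
  qed
  moreover have "incseq A"
    by (rule incseq_SucI) (auto simp: A_def S_def intro: order_trans[OF _ fst_crossing_step])
  ultimately have "emeasure Q (\<Union>n. A n) \<le> ennreal ((a / b) ^ K)"
    by (subst SUP_emeasure_incseq[symmetric]) (auto intro!: SUP_least)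
  also have "(\<Union>n. A n) = {\<omega>\<in>space Q. \<exists>n. K \<le> fst (crossing a b (\<lambda>n. M n \<omega>) n)}"
    by (auto simp: A_def S_def)
  finally show ?thesis .
qed

text \<open>Unboundedly many upcrossings have probability at most \<open>(a / b) ^ K\<close> for
  every \<open>K\<close>, and this tends to 0.\<close>

lemma AE_no_crossing:
  fixes a b :: real
  assumes "0 < a" "a < b"
  shows "AE \<omega> in Q. \<exists>K. \<forall>n. fst (crossing a b (\<lambda>n. M n \<omega>) n) < K"
proof (rule AE_I)
  define N where "N = {\<omega>\<in>space Q. \<forall>K. \<exists>n. K \<le> fst (crossing a b (\<lambda>n. M n \<omega>) n)}"
  note [measurable] = measurable_Q[OF crossing_measurable]
  show "N \<in> sets Q" unfolding N_def by measurable
  show "{\<omega>\<in>space Q. \<not> (\<exists>K. \<forall>n. fst (crossing a b (\<lambda>n. M n \<omega>) n) < K)} \<subseteq> N"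
    by (auto simp: N_def not_less)
  have "emeasure Q N \<le> ennreal ((a / b) ^ K)" for K
  proof -
    have "emeasure Q N \<le> emeasure Q {\<omega>\<in>space Q. \<exists>n. K \<le> fst (crossing a b (\<lambda>n. M n \<omega>) n)}"
      by (rule emeasure_mono, auto simp: N_def) measurable
    also note Dubins_inequality[OF assms]
    finally show ?thesis .
  qed
  moreover have "(\<lambda>K. ennreal ((a / b) ^ K)) \<longlonglongrightarrow> ennreal 0"
    using assms by (intro tendsto_ennrealI LIMSEQ_realpow_zero) auto
  ultimately show "emeasure Q N = 0"
    using LIMSEQ_le_const[of "\<lambda>K. ennreal ((a / b) ^ K)" 0 "emeasure Q N"] by simp
qed

text \<open>A gap between limit inferior and limit superior would contain a rational interval
  crossed infinitely often, an event that is null for each of the countably many intervals.\<close>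

lemma AE_limsup_eq_liminf: "AE \<omega> in Q. limsup (\<lambda>n. M n \<omega>) = liminf (\<lambda>n. M n \<omega>)"
proof -
  have "AE \<omega> in Q. \<forall>a b :: rat. 0 < a \<longrightarrow> a < b \<longrightarrow>
      (\<exists>K. \<forall>n. fst (crossing (real_of_rat a) (real_of_rat b) (\<lambda>n. M n \<omega>) n) < K)"
    unfolding AE_all_countable
    by (intro allI AE_impI AE_no_crossing) (auto simp: of_rat_less)
  then show ?thesis
  proof (rule AE_mp, intro AE_I2 impI)
    fix \<omega>
    assume bounded: "\<forall>a b :: rat. 0 < a \<longrightarrow> a < b \<longrightarrow>
      (\<exists>K. \<forall>n. fst (crossing (real_of_rat a) (real_of_rat b) (\<lambda>n. M n \<omega>) n) < K)"
    show "limsup (\<lambda>n. M n \<omega>) = liminf (\<lambda>n. M n \<omega>)"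
    proof (rule ccontr)
      assume "limsup (\<lambda>n. M n \<omega>) \<noteq> liminf (\<lambda>n. M n \<omega>)"
      then have "liminf (\<lambda>n. M n \<omega>) < limsup (\<lambda>n. M n \<omega>)"
        using Liminf_le_Limsup[of sequentially "\<lambda>n. M n \<omega>"] by simp
      then obtain a b :: rat where ab: "0 < a" "a < b"
        "liminf (\<lambda>n. M n \<omega>) < ennreal (of_rat a)" "ennreal (of_rat b) < limsup (\<lambda>n. M n \<omega>)"
        by (rule ennreal_between_rats)
      have "\<exists>\<^sub>F n in sequentially. M n \<omega> \<le> ennreal (of_rat a)"
      proof (rule ccontr)
        assume "\<not> ?thesis"
        then have "\<forall>\<^sub>F n in sequentially. ennreal (of_rat a) \<le> M n \<omega>"
          by (auto simp: frequently_def not_le elim: eventually_mono)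
        then have "ennreal (of_rat a) \<le> liminf (\<lambda>n. M n \<omega>)" by (rule Liminf_bounded)
        then show False using ab(3) by (simp add: leD)
      qed
      moreover have "\<exists>\<^sub>F n in sequentially. ennreal (of_rat b) \<le> M n \<omega>"
      proof (rule ccontr)
        assume "\<not> ?thesis"
        then have "\<forall>\<^sub>F n in sequentially. M n \<omega> \<le> ennreal (of_rat b)"
          by (auto simp: frequently_def not_le elim: eventually_mono)
        then have "limsup (\<lambda>n. M n \<omega>) \<le> ennreal (of_rat b)" by (rule Limsup_bounded)
        then show False using ab(4) by (simp add: leD)
      qed
      ultimately show False
        using bounded ab(1,2) crossing_unbounded by (meson not_le)
    qed
  qed
qed

text \<open>Fatou's lemma bounds only the limit inferior; almost sure convergence carries the bound
  over to the limit superior, which is what an infinite stopping time evaluates.\<close>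

theorem nn_integral_limsup_le: "(\<integral>\<^sup>+ \<omega>. limsup (\<lambda>n. M n \<omega>) \<partial>Q) \<le> (\<integral>\<^sup>+ \<omega>. M 0 \<omega> \<partial>Q)"
proof -
  have "(\<integral>\<^sup>+ \<omega>. limsup (\<lambda>n. M n \<omega>) \<partial>Q) = (\<integral>\<^sup>+ \<omega>. liminf (\<lambda>n. M n \<omega>) \<partial>Q)"
    by (rule nn_integral_cong_AE) (rule AE_limsup_eq_liminf)
  also have "\<dots> \<le> liminf (\<lambda>n. \<integral>\<^sup>+ \<omega>. M n \<omega> \<partial>Q)"
    by (rule nn_integral_liminf) measurable
  also have "\<dots> \<le> (\<integral>\<^sup>+ \<omega>. M 0 \<omega> \<partial>Q)"
    using nn_integral_le by (intro Liminf_le) auto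
  finally show ?thesis .
qed

text \<open>The stopped process stands still on \<open>\<tau> \<omega> \<le> enat n\<close>, an
  event known at time \<open>n\<close>, and follows \<open>M\<close> elsewhere. Splitting the test
  function into \<open>H1\<close> and \<open>H2\<close> along this event leaves \<open>super\<close>
  to be applied to \<open>H2\<close> only.\<close>

lemma stopped:
  fixes \<tau> :: "'a \<Rightarrow> enat"
  assumes \<tau>: "\<And>n. Measurable.pred (F n) (\<lambda>\<omega>. \<tau> \<omega> \<le> enat n)"
  defines "N \<equiv> \<lambda>n \<omega>. M (case \<tau> \<omega> of enat k \<Rightarrow> min n k | \<infinity> \<Rightarrow> n) \<omega>"
  shows "nonneg_supermartingale Q F N"
proof -
  have N0: "N 0 = M 0" by (auto simp: N_def split: enat.split)
  have N_Suc: "N (Suc n) \<omega> = (if \<tau> \<omega> \<le> enat n then N n \<omega> else M (Suc n) \<omega>)" for n \<omega>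
    by (auto simp: N_def split: enat.split)
  have N_eq: "N n \<omega> = M n \<omega>" if "\<not> \<tau> \<omega> \<le> enat n" for n \<omega>
    using that by (auto simp: N_def split: enat.split)
  have N: "N n \<in> borel_measurable (F n)" for n
  proof (induction n)
    case (Suc n)
    note [measurable] = measurable_Suc[OF Suc] measurable_Suc[OF \<tau>]
    show ?case unfolding N_Suc by measurable
  qed (simp add: N0)
  show ?thesis
  proof
    fix n and H :: "'a \<Rightarrow> ennreal" assume H [measurable]: "H \<in> borel_measurable (F n)"
    note [measurable] = \<tau>[of n] N[of n]
    define H1 where "H1 \<omega> = (if \<tau> \<omega> \<le> enat n then H \<omega> else 0)" for \<omega>
    define H2 where "H2 \<omega> = (if \<tau> \<omega> \<le> enat n then 0 else H \<omega>)" for \<omega>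
    have H1: "H1 \<in> borel_measurable (F n)" and H2: "H2 \<in> borel_measurable (F n)"
      unfolding H1_def H2_def by measurable
    note [measurable] = H1[THEN measurable_Q] H2[THEN measurable_Q] N[THEN measurable_Q]
    have "(\<integral>\<^sup>+ \<omega>. H \<omega> * N (Suc n) \<omega> \<partial>Q) = (\<integral>\<^sup>+ \<omega>. H1 \<omega> * N n \<omega> + H2 \<omega> * M (Suc n) \<omega> \<partial>Q)"
      by (intro nn_integral_cong) (auto simp: H1_def H2_def N_Suc)
    also have "\<dots> = (\<integral>\<^sup>+ \<omega>. H1 \<omega> * N n \<omega> \<partial>Q) + (\<integral>\<^sup>+ \<omega>. H2 \<omega> * M (Suc n) \<omega> \<partial>Q)"
      by (intro nn_integral_add) measurable
    also have "\<dots> \<le> (\<integral>\<^sup>+ \<omega>. H1 \<omega> * N n \<omega> \<partial>Q) + (\<integral>\<^sup>+ \<omega>. H2 \<omega> * M n \<omega> \<partial>Q)"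
      by (intro add_left_mono super H2)
    also have "\<dots> = (\<integral>\<^sup>+ \<omega>. H1 \<omega> * N n \<omega> + H2 \<omega> * M n \<omega> \<partial>Q)"
      by (intro nn_integral_add[symmetric]) measurable
    also have "\<dots> = (\<integral>\<^sup>+ \<omega>. H \<omega> * N n \<omega> \<partial>Q)"
      by (intro nn_integral_cong) (auto simp: H1_def H2_def N_eq)
    finally show "(\<integral>\<^sup>+ \<omega>. H \<omega> * N (Suc n) \<omega> \<partial>Q) \<le> (\<integral>\<^sup>+ \<omega>. H \<omega> * N n \<omega> \<partial>Q)" .
  qed (use subalg sets_mono N in auto)
qed

end

section \<open>Words, cylinders and the filtration\<close>

definition cyl :: "nat \<Rightarrow> (nat \<Rightarrow> bool) \<Rightarrow> (nat \<Rightarrow> bool) set" where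
  "cyl t \<omega> = {\<omega>' \<in> space seq_space. \<forall>s\<in>{1..t}. \<omega>' s = \<omega> s}"

text \<open>A word of length \<open>t\<close> is encoded as the sequence that continues it by zeros.\<close>

definition words :: "nat \<Rightarrow> (nat \<Rightarrow> bool) set" where
  "words t = {\<omega> \<in> space seq_space. \<forall>s>t. \<not> \<omega> s}"

text \<open>This is the only word whose cylinder of length \<open>t\<close> contains
  \<open>\<omega>\<close>. Restriction to \<open>{1..}\<close> keeps it extensional, as points of
  \<open>seq_space\<close> are.\<close>

definition trunc :: "nat \<Rightarrow> (nat \<Rightarrow> bool) \<Rightarrow> nat \<Rightarrow> bool" where
  "trunc t \<omega> = (\<lambda>s\<in>{1..}. s \<le> t \<and> \<omega> s)"

lemma space_seq_space: "space seq_space = extensional {1..}"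
  by (simp add: seq_space_def space_PiM PiE_def)

lemma coord_measurable [measurable]: "s \<in> {1..} \<Longrightarrow> (\<lambda>\<omega>. \<omega> s) \<in> measurable seq_space (count_space UNIV)"
  unfolding seq_space_def by (rule measurable_component_singleton)

lemma fun_upd_in_seq_space: "\<omega> \<in> space seq_space \<Longrightarrow> fun_upd \<omega> (Suc t) b \<in> space seq_space"
  by (auto simp: space_seq_space extensional_def)

lemma trunc_in_words: "trunc t \<omega> \<in> words t"
  by (auto simp: trunc_def words_def space_seq_space)

lemma trunc_eq: "s \<in> {1..t} \<Longrightarrow> trunc t \<omega> s = \<omega> s"
  by (auto simp: trunc_def)

lemma words_subset: "words t \<subseteq> space seq_space"
  by (auto simp: words_def)

lemma words_0: "words 0 = {\<lambda>s\<in>{1..}. False}"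
proof (intro equalityI subsetI)
  fix \<omega> assume "\<omega> \<in> words 0"
  then have "\<omega> \<in> extensional {1..}" "\<And>s. s \<in> {1..} \<Longrightarrow> \<omega> s = (\<lambda>s\<in>{1..}. False) s"
    by (simp_all add: words_def space_seq_space)
  then show "\<omega> \<in> {\<lambda>s\<in>{1..}. False}"
    using extensionalityI[of \<omega> "{1..}" "\<lambda>s\<in>{1..}. False"] by simp
qed (simp add: words_def space_seq_space)

lemma words_Suc: "words (Suc t) = words t \<union> (\<lambda>\<omega>. fun_upd \<omega> (Suc t) True) ` words t"
proof (intro equalityI subsetI)
  fix \<omega> assume w: "\<omega> \<in> words (Suc t)"
  show "\<omega> \<in> words t \<union> (\<lambda>\<omega>. fun_upd \<omega> (Suc t) True) ` words t"
  proof (cases "\<omega> (Suc t)")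
    case True
    then have "\<omega> = (fun_upd \<omega> (Suc t) False)(Suc t := True)" by (simp add: fun_eq_iff)
    moreover have "fun_upd \<omega> (Suc t) False \<in> words t"
      using w fun_upd_in_seq_space by (auto simp: words_def)
    ultimately show ?thesis by blast
  next
    case False
    then have "\<omega> \<in> words t"
      using w by (auto simp: words_def) (metis Suc_lessI)
    then show ?thesis by simp
  qed
qed (auto simp: words_def fun_upd_in_seq_space)

lemma finite_words [simp, intro]: "finite (words t)"
  by (induction t) (auto simp: words_0 words_Suc)

text \<open>A word of length \<open>Suc t\<close> is a prefix with a last bit; updating the prefix
  by \<open>False\<close> changes nothing, because it is already continued by zeros.\<close>

lemma sum_words_Suc:
  fixes f :: "_ \<Rightarrow> 'b::comm_monoid_add"
  shows "sum f (words (Suc t)) = (\<Sum>\<omega>\<in>words t. f (fun_upd \<omega> (Suc t) False) + f (fun_upd \<omega> (Suc t) True))"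
proof -
  have disj: "words t \<inter> (\<lambda>\<omega>. fun_upd \<omega> (Suc t) True) ` words t = {}"
    by (auto simp: words_def)
  have inj: "inj_on (\<lambda>\<omega>. fun_upd \<omega> (Suc t) True) (words t)"
  proof (rule inj_onI, rule ext)
    fix \<omega> \<omega>' s assume "\<omega> \<in> words t" "\<omega>' \<in> words t" and eq: "fun_upd \<omega> (Suc t) True = fun_upd \<omega>' (Suc t) True"
    then have "\<omega> (Suc t) = \<omega>' (Suc t)" by (simp add: words_def)
    then show "\<omega> s = \<omega>' s" using fun_cong[OF eq, of s] by (auto split: if_splits)
  qed
  have "fun_upd \<omega> (Suc t) False = \<omega>" if "\<omega> \<in> words t" for \<omega>
    using that by (auto simp: words_def fun_eq_iff)
  then show ?thesis
    by (simp add: words_Suc sum.union_disjoint disj sum.reindex[OF inj] sum.distrib)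
qed

lemma space_F [simp]: "space (\<F> t) = space seq_space"
  by (simp add: \<F>_def space_measure_of_conv)

lemma sets_F: "sets (\<F> t) = sigma_sets (space seq_space)
    {X s -` A \<inter> space seq_space | s A. 1 \<le> s \<and> enat s \<le> t}"
  unfolding \<F>_def by (rule sets_measure_of) auto

lemma sets_F_subset: "sets (\<F> t) \<subseteq> sets seq_space"
proof -
  have "X s -` A \<inter> space seq_space \<in> sets seq_space" if "1 \<le> s" for s A
    unfolding X_def using that by (intro measurable_sets[OF coord_measurable]) auto
  then show ?thesis unfolding sets_F by (intro sets.sigma_sets_subset) auto
qed

lemma sets_F_mono: "t \<le> u \<Longrightarrow> sets (\<F> t) \<subseteq> sets (\<F> u)"
  unfolding sets_F by (intro sigma_sets_mono') (blast intro: order_trans)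

text \<open>No generator separates two points that agree up to time \<open>t\<close>, and
  complements and countable unions preserve this.\<close>

lemma sets_F_determined:
  assumes "A \<in> sets (\<F> (enat t))" "\<omega> \<in> space seq_space" "\<omega>' \<in> space seq_space"
    and "\<And>s. s \<in> {1..t} \<Longrightarrow> \<omega> s = \<omega>' s"
  shows "\<omega> \<in> A \<longleftrightarrow> \<omega>' \<in> A"
  using assms(1) unfolding sets_F
proof (induction rule: sigma_sets.induct)
  case (Basic A)
  then obtain s B where "A = X s -` B \<inter> space seq_space" "s \<in> {1..t}" by auto
  with assms(2,3) assms(4)[of s] show ?case by (simp add: X_def)
qed (use assms(2,3) in simp_all)

lemma measurable_F_determined:
  fixes f :: "_ \<Rightarrow> 'b::t1_space"
  assumes "f \<in> borel_measurable (\<F> (enat t))" "\<omega> \<in> space seq_space" "\<omega>' \<in> space seq_space"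
    and "\<And>s. s \<in> {1..t} \<Longrightarrow> \<omega> s = \<omega>' s"
  shows "f \<omega> = f \<omega>'"
proof -
  have "f -` {f \<omega>} \<inter> space (\<F> (enat t)) \<in> sets (\<F> (enat t))"
    by (rule measurable_sets[OF assms(1)]) simp
  then have "\<omega> \<in> f -` {f \<omega>} \<inter> space (\<F> (enat t)) \<longleftrightarrow> \<omega>' \<in> f -` {f \<omega>} \<inter> space (\<F> (enat t))"
    by (rule sets_F_determined) (fact assms)+
  with assms(2,3) show ?thesis by simp
qed

lemma cyl_in_F [measurable]: "cyl t \<omega> \<in> sets (\<F> (enat t))"
proof -
  have "{\<omega>' \<in> space (\<F> (enat t)). \<forall>s\<in>{1..t}. \<omega>' s = \<omega> s} \<in> sets (\<F> (enat t))"
  proof (rule sets.sets_Collect_finite_All)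
    fix s assume "s \<in> {1..t}"
    then have "X s -` {\<omega> s} \<inter> space seq_space \<in> sets (\<F> (enat t))"
      unfolding sets_F by (intro sigma_sets.Basic) auto
    also have "X s -` {\<omega> s} \<inter> space seq_space = {\<omega>' \<in> space (\<F> (enat t)). \<omega>' s = \<omega> s}"
      by (simp add: X_def vimage_def Int_def conj_commute)
    finally show "{\<omega>' \<in> space (\<F> (enat t)). \<omega>' s = \<omega> s} \<in> sets (\<F> (enat t))" .
  qed simp
  then show ?thesis by (simp add: cyl_def)
qed

lemma cyl_iff:
  assumes "\<omega> \<in> words t" "\<omega>' \<in> space seq_space"
  shows "\<omega>' \<in> cyl t \<omega> \<longleftrightarrow> \<omega> = trunc t \<omega>'"
proof
  assume c: "\<omega>' \<in> cyl t \<omega>"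
  show "\<omega> = trunc t \<omega>'"
  proof (rule extensionalityI[of _ "{1..}"])
    fix s :: nat assume "s \<in> {1..}"
    then show "\<omega> s = trunc t \<omega>' s"
      using c assms(1) by (cases "s \<le> t") (simp_all add: cyl_def words_def trunc_def)
  qed (use assms(1) in \<open>simp_all add: words_def space_seq_space trunc_def\<close>)
qed (use assms(2) in \<open>simp add: cyl_def trunc_eq\<close>)

text \<open>Converse of \<open>sets_F_determined\<close>: such a set is the finite union of the
  cylinders of the words it contains.\<close>

lemma determined_in_F:
  assumes "A \<subseteq> space seq_space"
    and "\<And>\<omega> \<omega>'. \<omega> \<in> A \<Longrightarrow> \<omega>' \<in> space seq_space \<Longrightarrow> (\<And>s. s \<in> {1..t} \<Longrightarrow> \<omega> s = \<omega>' s) \<Longrightarrow> \<omega>' \<in> A"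
  shows "A \<in> sets (\<F> (enat t))"
proof -
  have "A = (\<Union>\<omega>\<in>words t \<inter> A. cyl t \<omega>)"
  proof (intro equalityI subsetI)
    fix \<omega> assume "\<omega> \<in> A"
    moreover have "trunc t \<omega> \<in> A"
      using trunc_in_words words_subset by (intro assms(2)[OF \<open>\<omega> \<in> A\<close>]) (auto simp: trunc_eq)
    ultimately show "\<omega> \<in> (\<Union>\<omega>\<in>words t \<inter> A. cyl t \<omega>)"
      using assms(1) trunc_in_words by (auto simp: cyl_def trunc_eq intro!: bexI[of _ "trunc t \<omega>"])
  next
    fix \<omega>' assume "\<omega>' \<in> (\<Union>\<omega>\<in>words t \<inter> A. cyl t \<omega>)"
    then obtain \<omega> where "\<omega> \<in> A" "\<omega>' \<in> cyl t \<omega>" by blast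
    then show "\<omega>' \<in> A" by (intro assms(2)[of \<omega> \<omega>']) (simp_all add: cyl_def)
  qed
  also have "\<dots> \<in> sets (\<F> (enat t))" by (intro sets.finite_UN) auto
  finally show ?thesis .
qed

lemma determined_measurable_F:
  assumes "\<And>\<omega> \<omega>'. \<omega> \<in> space seq_space \<Longrightarrow> \<omega>' \<in> space seq_space \<Longrightarrow>
      (\<And>s. s \<in> {1..t} \<Longrightarrow> \<omega> s = \<omega>' s) \<Longrightarrow> f \<omega> = f \<omega>'"
    and "f \<in> space seq_space \<rightarrow> space N"
  shows "f \<in> measurable (\<F> (enat t)) N"
proof (rule measurableI)
  fix A assume "A \<in> sets N"
  show "f -` A \<inter> space (\<F> (enat t)) \<in> sets (\<F> (enat t))"
  proof (rule determined_in_F)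
    fix \<omega> \<omega>' assume "\<omega> \<in> f -` A \<inter> space (\<F> (enat t))" "\<omega>' \<in> space seq_space"
      "\<And>s. s \<in> {1..t} \<Longrightarrow> \<omega> s = \<omega>' s"
    with assms(1)[of \<omega> \<omega>'] show "\<omega>' \<in> f -` A \<inter> space (\<F> (enat t))" by simp
  qed simp
qed (use assms(2) in auto)

text \<open>The integrand is constant on each of the finitely many cylinders, so a law enters only
  through its cylinder probabilities.\<close>

lemma nn_integral_words:
  assumes Q: "sets Q = sets seq_space" and f: "f \<in> borel_measurable (\<F> (enat t))"
  shows "(\<integral>\<^sup>+ \<omega>. f \<omega> \<partial>Q) = (\<Sum>\<omega>\<in>words t. f \<omega> * emeasure Q (cyl t \<omega>))"
proof -
  have sp: "space Q = space seq_space" by (rule sets_eq_imp_space_eq[OF Q])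
  have [measurable]: "cyl t \<omega> \<in> sets Q" for \<omega>
    using cyl_in_F sets_F_subset Q by blast
  have "(\<integral>\<^sup>+ \<omega>. f \<omega> \<partial>Q) = (\<integral>\<^sup>+ \<omega>'. (\<Sum>\<omega>\<in>words t. f \<omega> * indicator (cyl t \<omega>) \<omega>') \<partial>Q)"
  proof (rule nn_integral_cong)
    fix \<omega>' assume "\<omega>' \<in> space Q"
    then have w: "\<omega>' \<in> space seq_space" by (simp add: sp)
    have "(\<Sum>\<omega>\<in>words t. f \<omega> * indicator (cyl t \<omega>) \<omega>') = (\<Sum>\<omega>\<in>words t. if \<omega> = trunc t \<omega>' then f \<omega> else 0)"
      using w by (intro sum.cong) (auto simp: cyl_iff indicator_def)
    also have "\<dots> = f (trunc t \<omega>')" by (simp add: trunc_in_words)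
    also have "\<dots> = f \<omega>'"
      using w trunc_in_words words_subset by (intro measurable_F_determined[OF f]) (auto simp: trunc_eq)
    finally show "f \<omega>' = (\<Sum>\<omega>\<in>words t. f \<omega> * indicator (cyl t \<omega>) \<omega>')" by simp
  qed
  also have "\<dots> = (\<Sum>\<omega>\<in>words t. f \<omega> * emeasure Q (cyl t \<omega>))"
    by (subst nn_integral_sum) (auto simp: nn_integral_cmult_indicator)
  finally show ?thesis .
qed

section \<open>Symbol and transition counts\<close>

lemma num_0: "num j 0 \<omega> = 0" by (simp add: num_def)

lemma num_Suc: "num j (Suc t) \<omega> = num j t \<omega> + (if \<omega> (Suc t) = j then 1 else 0)"
proof -
  have "{s\<in>{1..Suc t}. X s \<omega> = j} = {s\<in>{1..t}. X s \<omega> = j} \<union> (if \<omega> (Suc t) = j then {Suc t} else {})"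
    by (auto simp: X_def le_Suc_eq)
  then show ?thesis by (simp add: num_def)
qed

lemma trans_count_1: "t \<le> 1 \<Longrightarrow> trans_count j i t \<omega> = 0"
  by (auto simp: trans_count_def)

text \<open>An earlier symbol is required, because the first symbol completes no transition.\<close>

lemma trans_count_Suc:
  "1 \<le> t \<Longrightarrow> trans_count j i (Suc t) \<omega> = trans_count j i t \<omega> + (if \<omega> t = i \<and> \<omega> (Suc t) = j then 1 else 0)"
proof -
  assume "1 \<le> t"
  then have "{s\<in>{2..Suc t}. X (s - 1) \<omega> = i \<and> X s \<omega> = j} =
    {s\<in>{2..t}. X (s - 1) \<omega> = i \<and> X s \<omega> = j} \<union> (if \<omega> t = i \<and> \<omega> (Suc t) = j then {Suc t} else {})"
    by (auto simp: X_def le_Suc_eq)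
  then show ?thesis by (simp add: trans_count_def)
qed

lemma num_cong: "(\<And>s. s \<in> {1..t} \<Longrightarrow> \<omega> s = \<omega>' s) \<Longrightarrow> num j t \<omega> = num j t \<omega>'"
  unfolding num_def by (intro arg_cong[where f=card]) (auto simp: X_def)

lemma trans_count_cong:
  assumes "\<And>s. s \<in> {1..t} \<Longrightarrow> \<omega> s = \<omega>' s"
  shows "trans_count j i t \<omega> = trans_count j i t \<omega>'"
proof -
  have "X s \<omega> = X s \<omega>'" "X (s - 1) \<omega> = X (s - 1) \<omega>'" if "s \<in> {2..t}" for s
  proof -
    from that have "s \<in> {1..t}" "s - 1 \<in> {1..t}" by auto
    then show "X s \<omega> = X s \<omega>'" "X (s - 1) \<omega> = X (s - 1) \<omega>'"
      using assms by (auto simp: X_def)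
  qed
  then show ?thesis
    unfolding trans_count_def by (intro arg_cong[where f=card] Collect_cong) auto
qed

lemma num_add: "num True t \<omega> + num False t \<omega> = t"
  by (induction t) (auto simp: num_0 num_Suc)

section \<open>Bernoulli likelihoods and Bernoulli laws\<close>

definition lik :: "real \<Rightarrow> nat \<Rightarrow> (nat \<Rightarrow> bool) \<Rightarrow> real" where
  "lik p t \<omega> = p ^ num True t \<omega> * (1 - p) ^ num False t \<omega>"

lemma lik_Suc: "lik p (Suc t) \<omega> = lik p t \<omega> * (if \<omega> (Suc t) then p else 1 - p)"
  by (simp add: lik_def num_Suc)

lemma lik_cong: "(\<And>s. s \<in> {1..t} \<Longrightarrow> \<omega> s = \<omega>' s) \<Longrightarrow> lik p t \<omega> = lik p t \<omega>'"
  unfolding lik_def using num_cong[of t \<omega> \<omega>'] by simp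

lemma lik_nonneg: "p \<in> {0..1} \<Longrightarrow> 0 \<le> lik p t \<omega>"
  by (simp add: lik_def)

lemma lik_prod: "lik p t \<omega> = (\<Prod>s\<in>{1..t}. if \<omega> s then p else 1 - p)"
  by (induction t) (simp_all add: lik_Suc, simp add: lik_def num_0)

text \<open>The empirical frequency maximizes the likelihood (Gibbs' inequality). If a count is
  zero, the right side is 1; otherwise \<open>x \<le> exp (x - 1)\<close> is applied to the ratio of
  the parameters for each symbol.\<close>

lemma lik_le_max:
  assumes "p \<in> {0..1}"
  shows "lik p t \<omega> \<le> lik (num True t \<omega> / t) t \<omega>"
proof -
  define m n where "m = num True t \<omega>" and "n = num False t \<omega>"
  have t: "t = m + n" using num_add[of t \<omega>] by (simp add: m_def n_def)
  consider "m = 0" | "n = 0" "m > 0" | "m > 0" "n > 0" by auto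
  then have "p ^ m * (1 - p) ^ n \<le> (m / t) ^ m * (1 - m / t) ^ n"
  proof cases
    case 1
    then show ?thesis using assms by (simp add: power_le_one)
  next
    case 2
    then show ?thesis using assms t by (simp add: power_le_one)
  next
    case 3
    define q where "q = m / t"
    have q: "0 < q" "q < 1" "1 - q = n / t" using 3 t by (auto simp: q_def field_simps)
    have ratio: "x ^ k \<le> y ^ k * exp (k * (x / y - 1))" if "0 \<le> x" "0 < y" for x y :: real and k :: nat
    proof -
      have "x / y \<le> exp (x / y - 1)" using exp_ge_add_one_self[of "x / y - 1"] by simp
      then have "x \<le> y * exp (x / y - 1)" using that by (simp add: field_simps)
      then have "x ^ k \<le> (y * exp (x / y - 1)) ^ k" using that by (intro power_mono) auto
      then show ?thesis by (simp add: power_mult_distrib exp_of_nat_mult)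
    qed
    have "p ^ m * (1 - p) ^ n \<le>
        (q ^ m * exp (m * (p / q - 1))) * ((1 - q) ^ n * exp (n * ((1 - p) / (1 - q) - 1)))"
      using assms q by (intro mult_mono ratio) auto
    also have "\<dots> = q ^ m * (1 - q) ^ n * exp (m * (p / q - 1) + n * ((1 - p) / (1 - q) - 1))"
      by (simp add: exp_add)
    \<comment> \<open>As \<open>q = m / t\<close>, the sum equals
      \<open>t * p - m + t * (1 - p) - n\<close>, which vanishes.\<close>
    also have "m * (p / q - 1) + n * ((1 - p) / (1 - q) - 1) = 0"
      using 3 t unfolding q(3) by (simp add: q_def field_simps)
    finally show ?thesis by (simp add: q_def)
  qed
  then show ?thesis by (simp add: lik_def m_def n_def)
qed

lemma sets_bernoulli_law: "sets (bernoulli_law p) = sets seq_space"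
  unfolding bernoulli_law_def seq_space_def by (intro sets_PiM_cong) auto

lemma space_bernoulli_law: "space (bernoulli_law p) = space seq_space"
  by (rule sets_eq_imp_space_eq[OF sets_bernoulli_law])

lemma prob_space_bernoulli_law: "prob_space (bernoulli_law p)"
  unfolding bernoulli_law_def by (intro prob_space_PiM prob_space_measure_pmf)

lemma emeasure_bernoulli_law_cyl:
  assumes "p \<in> {0..1}"
  shows "emeasure (bernoulli_law p) (cyl t \<omega>) = ennreal (lik p t \<omega>)"
proof -
  interpret product_prob_space "\<lambda>_::nat. measure_pmf (bernoulli_pmf p)" "{1..}" ..
  have "emeasure (bernoulli_law p) (cyl t \<omega>) =
      emeasure (bernoulli_law p) {\<omega>'\<in>space (bernoulli_law p). \<forall>s\<in>{1..t}. \<omega>' s \<in> {\<omega> s}}"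
    by (simp add: cyl_def space_bernoulli_law)
  also have "\<dots> = (\<Prod>s\<in>{1..t}. emeasure (measure_pmf (bernoulli_pmf p)) {\<omega> s})"
    unfolding bernoulli_law_def by (intro emeasure_PiM_Collect) auto
  also have "\<dots> = (\<Prod>s\<in>{1..t}. ennreal (if \<omega> s then p else 1 - p))"
    using assms by (intro prod.cong) (auto simp: emeasure_pmf_single)
  also have "\<dots> = ennreal (lik p t \<omega>)"
    unfolding lik_prod using assms by (intro prod_ennreal) auto
  finally show ?thesis .
qed

section \<open>The Krichevsky-Trofimov mixture and the ratio \<open>R\<close>\<close>

text \<open>\<open>kt\<close> is the probability of a word under the Krichevsky-Trofimov mixture of first-order
  Markov chains: the product of the predictive probabilities
  $(n_{j|i} + 1/2) / (n_{0|i} + n_{1|i} + 1)$, started from a uniform bit.\<close>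

definition kt :: "nat \<Rightarrow> (nat \<Rightarrow> bool) \<Rightarrow> real" where
  "kt t \<omega> = (if t = 0 then 1 else
     let n00 = trans_count False False t \<omega>; n01 = trans_count False True t \<omega>;
         n10 = trans_count True False t \<omega>; n11 = trans_count True True t \<omega>
     in Gamma (real n00 + 1/2) * Gamma (real n01 + 1/2) *
           Gamma (real n10 + 1/2) * Gamma (real n11 + 1/2) /
         (2 * Gamma (1/2) ^ 4 * Gamma (real n00 + real n10 + 1) * Gamma (real n01 + real n11 + 1)))"

lemma kt_nonneg: "0 \<le> kt t \<omega>"
  by (auto simp: kt_def Let_def intro!: divide_nonneg_nonneg mult_nonneg_nonneg Gamma_real_nonneg)

lemma kt_cong: "(\<And>s. s \<in> {1..t} \<Longrightarrow> \<omega> s = \<omega>' s) \<Longrightarrow> kt t \<omega> = kt t \<omega>'"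
  unfolding kt_def using trans_count_cong[of t \<omega> \<omega>'] by simp

text \<open>For one conditioning symbol the predictive probabilities
  \<open>(a + 1/2) / (a + b + 1)\<close> and \<open>(b + 1/2) / (a + b + 1)\<close> sum to 1; the
  recursion \<open>Gamma (x + 1) = x * Gamma x\<close> extracts them.\<close>

lemma kt_split:
  fixes a b :: nat
  shows "Gamma (Suc a + 1/2) * Gamma (b + 1/2) / Gamma (real (Suc a) + b + 1) +
         Gamma (a + 1/2) * Gamma (Suc b + 1/2) / Gamma (a + real (Suc b) + 1) =
         Gamma (a + 1/2) * Gamma (b + 1/2) / Gamma (real a + b + 1 :: real)"
proof -
  have step: "Gamma (x + 1) = x * Gamma x" if "0 < x" for x :: real
    using that by (intro Gamma_plus1) (auto simp: nonpos_Ints_def)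
  have "Gamma (Suc a + 1/2) = (a + 1/2) * Gamma (a + 1/2 :: real)"
    using step[of "a + 1/2"] by (simp add: algebra_simps)
  moreover have "Gamma (Suc b + 1/2) = (b + 1/2) * Gamma (b + 1/2 :: real)"
    using step[of "b + 1/2"] by (simp add: algebra_simps)
  moreover have "Gamma (real (Suc a) + b + 1) = (real a + b + 1) * Gamma (real a + b + 1)"
    using step[of "real a + b + 1"] by (simp add: algebra_simps)
  moreover have "Gamma (a + real (Suc b) + 1) = (real a + b + 1) * Gamma (real a + b + 1)"
    using step[of "real a + b + 1"] by (simp add: algebra_simps)
  moreover have "x * A * B / ((x + y) * C) + A * (y * B) / ((x + y) * C) = A * B / C"
    if "0 < x" "0 < y" for x y A B C :: real
  proof -
    have "x * A * B / ((x + y) * C) + A * (y * B) / ((x + y) * C) = ((x + y) * (A * B)) / ((x + y) * C)"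
      by (simp add: algebra_simps flip: add_divide_distrib)
    also have "\<dots> = A * B / C" using that by (intro mult_divide_mult_cancel_left) simp
    finally show ?thesis .
  qed
  note this[of "a + 1/2" "b + 1/2" "Gamma (a + 1/2)" "Gamma (b + 1/2)" "Gamma (real a + b + 1)"]
  ultimately show ?thesis by (simp add: add_ac)
qed

text \<open>Consistency of \<open>kt\<close> as a probability on words: a new symbol changes only
  the factor belonging to the last symbol \<open>\<omega> t\<close>, and \<open>kt_split\<close>
  sums it out.\<close>

lemma kt_Suc: "kt (Suc t) (fun_upd \<omega> (Suc t) False) + kt (Suc t) (fun_upd \<omega> (Suc t) True) = kt t \<omega>"
proof (cases "t = 0")
  case True
  have "Gamma (1/2 :: real) \<noteq> 0" by (simp add: Gamma_one_half_real)
  \<comment> \<open>Each one-symbol word gets 1/2: all transition counts are 0, the four Gamma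
    factors cancel, and the initial 2 remains.\<close>
  then show ?thesis using True by (simp add: kt_def trans_count_1 power4_eq_xxxx)
next
  case False
  define G where "G a b = Gamma (real a + 1/2) * Gamma (real b + 1/2) / Gamma (real a + real b + 1)" for a b :: nat
  have G: "G (Suc a) b + G a (Suc b) = G a b" for a b
    using kt_split[of a b] by (simp add: G_def)
  have kt_G: "kt s \<omega> = G (trans_count False False s \<omega>) (trans_count True False s \<omega>) *
      G (trans_count False True s \<omega>) (trans_count True True s \<omega>) / (2 * Gamma (1/2) ^ 4)" if "s \<noteq> 0" for s \<omega>
    using that by (simp add: kt_def Let_def G_def mult_ac)
  have upd: "trans_count j i t (fun_upd \<omega> (Suc t) b) = trans_count j i t \<omega>" for i j b
    by (rule trans_count_cong) auto
  have tc: "trans_count j i (Suc t) (fun_upd \<omega> (Suc t) b) = trans_count j i t \<omega> + (if \<omega> t = i \<and> b = j then 1 else 0)" for i j b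
    using False by (simp add: trans_count_Suc upd)
  have G': "c * G a (Suc b) + c * G (Suc a) b = c * G a b" for a b c
    by (simp only: distrib_left[symmetric] add.commute[of "G a (Suc b)"] G)
  show ?thesis using False
    by (cases "\<omega> t") (simp_all add: kt_G tc G' add_divide_distrib[symmetric] algebra_simps)
qed

text \<open>The denominator of \<open>R\<close> is the likelihood at the empirical frequency. At
  \<open>t = 0\<close> that frequency is \<open>0 / 0 = 0\<close>, but the exponents vanish and both
  sides equal 1.\<close>

lemma R_eq: "R t \<omega> = kt t \<omega> / lik (num True t \<omega> / t) t \<omega>"
proof (cases "t = 0")
  case False
  then have "1 - num True t \<omega> / t = num False t \<omega> / t"
    using num_add[of t \<omega>] by (simp add: field_simps flip: of_nat_add)
  then show ?thesis using False by (simp add: R_def kt_def lik_def Let_def)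
qed (simp add: R_def kt_def lik_def num_0)

lemma R_nonneg: "0 \<le> R t \<omega>"
  unfolding R_eq using num_add[of t \<omega>]
  by (intro divide_nonneg_nonneg kt_nonneg lik_nonneg) (auto simp: divide_le_eq)

lemma R_cong: "(\<And>s. s \<in> {1..t} \<Longrightarrow> \<omega> s = \<omega>' s) \<Longrightarrow> R t \<omega> = R t \<omega>'"
  unfolding R_eq using kt_cong[of t \<omega> \<omega>'] num_cong[of t \<omega> \<omega>'] lik_cong[of t \<omega> \<omega>'] by metis

lemma R_measurable: "R t \<in> borel_measurable (\<F> (enat t))"
  by (rule determined_measurable_F) (auto intro: R_cong)

text \<open>A vanishing likelihood is excluded because division by zero yields 0, which is no upper
  bound for a positive \<open>R\<close>; \<open>AE_lik_nonzero\<close> shows that the exception is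
  null.\<close>

lemma R_le:
  assumes "p \<in> {0..1}" "lik p t \<omega> \<noteq> 0"
  shows "R t \<omega> \<le> kt t \<omega> / lik p t \<omega>"
  unfolding R_eq using lik_le_max[OF assms(1), of t \<omega>] lik_nonneg[OF assms(1), of t \<omega>] assms(2)
  by (intro divide_left_mono kt_nonneg mult_pos_pos) auto

section \<open>The likelihood ratio under a Bernoulli law\<close>

lemma subalgebra_F: "sets Q = sets seq_space \<Longrightarrow> subalgebra Q (\<F> t)"
  using sets_F_subset[of t] sets_eq_imp_space_eq[of Q seq_space] by (simp add: subalgebra_def)

text \<open>On a cylinder its probability \<open>lik p t\<close> cancels the denominator and leaves
  \<open>kt\<close>, which \<open>kt_Suc\<close> sums over the next symbol. Equality can fail when
  \<open>p\<close> is 0 or 1: the mass \<open>kt\<close> gives to impossible words is lost.\<close>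

lemma likelihood_ratio_supermartingale:
  assumes p: "p \<in> {0..1}"
  shows "nonneg_supermartingale (bernoulli_law p) (\<lambda>t. \<F> (enat t))
    (\<lambda>t \<omega>. ennreal (kt t \<omega> / lik p t \<omega>))"
proof -
  interpret prob_space "bernoulli_law p" by (rule prob_space_bernoulli_law)
  let ?M = "\<lambda>t \<omega>. ennreal (kt t \<omega> / lik p t \<omega>)"
  have M: "?M t \<in> borel_measurable (\<F> (enat t))" for t
  proof (rule determined_measurable_F)
    fix \<omega> \<omega>' :: "nat \<Rightarrow> bool" assume "\<And>s. s \<in> {1..t} \<Longrightarrow> \<omega> s = \<omega>' s"
    then have "kt t \<omega> = kt t \<omega>'" "lik p t \<omega> = lik p t \<omega>'" by (blast intro: kt_cong lik_cong)+
    then show "?M t \<omega> = ?M t \<omega>'" by simp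
  qed simp
  show ?thesis
  proof
    fix t and H :: "_ \<Rightarrow> ennreal" assume H: "H \<in> borel_measurable (\<F> (enat t))"
    have "\<F> (enat t) \<rightarrow>\<^sub>M borel \<subseteq> \<F> (enat (Suc t)) \<rightarrow>\<^sub>M borel"
      by (rule measurable_mono) (simp_all add: sets_F_mono)
    with H have H': "H \<in> borel_measurable (\<F> (enat (Suc t)))" by blast
    have step: "(\<Sum>b\<in>{False, True}. H (fun_upd \<omega> (Suc t) b) * ?M (Suc t) (fun_upd \<omega> (Suc t) b) *
        ennreal (lik p (Suc t) (fun_upd \<omega> (Suc t) b)))
      \<le> H \<omega> * ?M t \<omega> * ennreal (lik p t \<omega>)" if w: "\<omega> \<in> words t" for \<omega>
    proof -
      have Hb: "H (fun_upd \<omega> (Suc t) b) = H \<omega>" for b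
        using w words_subset by (intro measurable_F_determined[OF H]) (auto intro: fun_upd_in_seq_space)
      have lt: "lik p t (fun_upd \<omega> (Suc t) b) = lik p t \<omega>" for b
        by (rule lik_cong) auto
      \<comment> \<open>\<open>K\<close> is the ratio multiplied by the likelihood; division by zero
        makes it 0 where the likelihood is 0.\<close>
      define K where "K s \<omega>' = (if lik p s \<omega>' = 0 then 0 else kt s \<omega>')" for s \<omega>'
      have K: "0 \<le> K s \<omega>'" for s \<omega>' by (simp add: K_def kt_nonneg)
      have prod: "H \<omega> * ?M s \<omega>' * ennreal (lik p s \<omega>') = H \<omega> * ennreal (K s \<omega>')" for s \<omega>'
        using p by (simp add: K_def mult.assoc ennreal_mult[symmetric] lik_nonneg kt_nonneg)
      \<comment> \<open>A zero likelihood is inherited by both extensions, so both sides are 0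
        there; otherwise at most some summands of \<open>kt_Suc\<close> are dropped.\<close>
      have le: "K (Suc t) (fun_upd \<omega> (Suc t) False) + K (Suc t) (fun_upd \<omega> (Suc t) True) \<le> K t \<omega>"
        unfolding K_def kt_Suc[of t \<omega>, symmetric] lik_Suc lt
        using kt_nonneg[of "Suc t" "fun_upd \<omega> (Suc t) False"] kt_nonneg[of "Suc t" "fun_upd \<omega> (Suc t) True"]
        by auto
      have "(\<Sum>b\<in>{False, True}. H (fun_upd \<omega> (Suc t) b) * ?M (Suc t) (fun_upd \<omega> (Suc t) b) *
          ennreal (lik p (Suc t) (fun_upd \<omega> (Suc t) b)))
        = H \<omega> * ennreal (K (Suc t) (fun_upd \<omega> (Suc t) False) + K (Suc t) (fun_upd \<omega> (Suc t) True))"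
        by (simp add: Hb prod K ennreal_plus distrib_left)
      also have "\<dots> \<le> H \<omega> * ennreal (K t \<omega>)"
        by (intro mult_left_mono ennreal_leI le) simp
      finally show ?thesis by (simp add: prod)
    qed
    have "(\<integral>\<^sup>+ \<omega>. H \<omega> * ?M (Suc t) \<omega> \<partial>bernoulli_law p) =
        (\<Sum>\<omega>\<in>words (Suc t). H \<omega> * ?M (Suc t) \<omega> * ennreal (lik p (Suc t) \<omega>))"
      using H' M[of "Suc t"] p
      by (subst nn_integral_words[where t="Suc t"]) (auto simp: sets_bernoulli_law emeasure_bernoulli_law_cyl)
    also have "\<dots> \<le> (\<Sum>\<omega>\<in>words t. H \<omega> * ?M t \<omega> * ennreal (lik p t \<omega>))"
      unfolding sum_words_Suc using step by (intro sum_mono) simp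
    also have "\<dots> = (\<integral>\<^sup>+ \<omega>. H \<omega> * ?M t \<omega> \<partial>bernoulli_law p)"
      using H M[of t] p
      by (subst nn_integral_words[where t=t]) (auto simp: sets_bernoulli_law emeasure_bernoulli_law_cyl)
    finally show "(\<integral>\<^sup>+ \<omega>. H \<omega> * ?M (Suc t) \<omega> \<partial>bernoulli_law p) \<le> (\<integral>\<^sup>+ \<omega>. H \<omega> * ?M t \<omega> \<partial>bernoulli_law p)" .
  qed (use M subalgebra_F[OF sets_bernoulli_law] in \<open>simp_all add: sets_F_mono\<close>)
qed

lemma emeasure_words:
  assumes Q: "sets Q = sets seq_space" and A: "A \<in> sets (\<F> (enat t))"
  shows "emeasure Q A = (\<Sum>\<omega>\<in>words t. indicator A \<omega> * emeasure Q (cyl t \<omega>))"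
proof -
  have "A \<in> sets Q" using A sets_F_subset Q by auto
  then have "emeasure Q A = (\<integral>\<^sup>+ \<omega>. indicator A \<omega> \<partial>Q)" by simp
  also have "\<dots> = (\<Sum>\<omega>\<in>words t. indicator A \<omega> * emeasure Q (cyl t \<omega>))"
    by (rule nn_integral_words[OF Q]) (use A in simp)
  finally show ?thesis .
qed

text \<open>For each \<open>t\<close> the exceptional set is a finite union of cylinders whose
  probability is the vanishing likelihood itself.\<close>

lemma AE_lik_nonzero:
  assumes p: "p \<in> {0..1}"
  shows "AE \<omega> in bernoulli_law p. \<forall>t. lik p t \<omega> \<noteq> 0"
  unfolding AE_all_countable
proof
  fix t
  define Z where "Z = {\<omega>\<in>space seq_space. lik p t \<omega> = 0}"
  have Z: "Z \<in> sets (\<F> (enat t))"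
  proof (rule determined_in_F)
    fix \<omega> \<omega>' assume "\<omega> \<in> Z" "\<omega>' \<in> space seq_space" and eq: "\<And>s. s \<in> {1..t} \<Longrightarrow> \<omega> s = \<omega>' s"
    moreover have "lik p t \<omega> = lik p t \<omega>'" by (rule lik_cong[OF eq])
    ultimately show "\<omega>' \<in> Z" by (simp add: Z_def)
  qed (simp add: Z_def)
  show "AE \<omega> in bernoulli_law p. lik p t \<omega> \<noteq> 0"
  proof (rule AE_I)
    show "{\<omega>\<in>space (bernoulli_law p). \<not> lik p t \<omega> \<noteq> 0} \<subseteq> Z"
      by (auto simp: Z_def space_bernoulli_law)
    show "Z \<in> sets (bernoulli_law p)" using Z sets_F_subset by (auto simp: sets_bernoulli_law)
    show "emeasure (bernoulli_law p) Z = 0"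
      unfolding emeasure_words[OF sets_bernoulli_law Z]
      by (rule sum.neutral) (use p in \<open>auto simp: Z_def emeasure_bernoulli_law_cyl indicator_def\<close>)
  qed
qed

text \<open>Finite and infinite values of \<open>\<tau>\<close> are treated alike: \<open>R\<close>
  at \<open>\<tau>\<close> is almost surely at most the limit superior of the stopped likelihood
  ratio \<open>N\<close>, which starts at 1.\<close>

lemma nn_integral_value_at_R_le:
  assumes p: "p \<in> {0..1}" and \<tau>: "stopping_time \<F> \<tau>"
  shows "(\<integral>\<^sup>+ \<omega>. value_at R \<tau> \<omega> \<partial>bernoulli_law p) \<le> 1"
proof -
  interpret M: nonneg_supermartingale "bernoulli_law p" "\<lambda>t. \<F> (enat t)"
    "\<lambda>t \<omega>. ennreal (kt t \<omega> / lik p t \<omega>)"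
    by (rule likelihood_ratio_supermartingale[OF p])
  define N where "N n \<omega> = ennreal (kt (case \<tau> \<omega> of enat k \<Rightarrow> min n k | \<infinity> \<Rightarrow> n) \<omega> /
    lik p (case \<tau> \<omega> of enat k \<Rightarrow> min n k | \<infinity> \<Rightarrow> n) \<omega>)" for n \<omega>
  interpret N: nonneg_supermartingale "bernoulli_law p" "\<lambda>t. \<F> (enat t)" N
    unfolding N_def by (rule M.stopped) (rule stopping_timeD[OF \<tau>])
  have "AE \<omega> in bernoulli_law p. value_at R \<tau> \<omega> \<le> limsup (\<lambda>n. N n \<omega>)"
    using AE_lik_nonzero[OF p]
  proof (rule AE_mp, intro AE_I2 impI)
    fix \<omega> assume "\<forall>t. lik p t \<omega> \<noteq> 0"
    then have le: "ennreal (R t \<omega>) \<le> ennreal (kt t \<omega> / lik p t \<omega>)" for t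
      by (intro ennreal_leI R_le p) simp
    show "value_at R \<tau> \<omega> \<le> limsup (\<lambda>n. N n \<omega>)"
    proof (cases "\<tau> \<omega>")
      case (enat k)
      have "(\<lambda>n. N n \<omega>) \<longlonglongrightarrow> ennreal (kt k \<omega> / lik p k \<omega>)"
        by (rule tendsto_eventually, rule eventually_sequentiallyI[of k]) (simp add: N_def enat min_absorb2)
      then have "limsup (\<lambda>n. N n \<omega>) = ennreal (kt k \<omega> / lik p k \<omega>)"
        by (intro lim_imp_Limsup) auto
      with le[of k] show ?thesis by (simp add: value_at_def enat)
    next
      case infinity
      then show ?thesis using le by (auto simp: value_at_def N_def intro!: Limsup_mono)
    qed
  qed
  then have "(\<integral>\<^sup>+ \<omega>. value_at R \<tau> \<omega> \<partial>bernoulli_law p) \<le> (\<integral>\<^sup>+ \<omega>. limsup (\<lambda>n. N n \<omega>) \<partial>bernoulli_law p)"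
    by (rule nn_integral_mono_AE)
  also have "\<dots> \<le> (\<integral>\<^sup>+ \<omega>. N 0 \<omega> \<partial>bernoulli_law p)"
    by (rule N.nn_integral_limsup_le)
  also have "N 0 = (\<lambda>_. 1)"
    by (auto simp: N_def fun_eq_iff kt_def lik_def num_0 split: enat.split)
  finally show ?thesis by (simp add: M.emeasure_space_1)
qed

lemma safe_e_process_R: "safe_e_process {bernoulli_law p | p. p \<in> {0..1}} R"
  unfolding safe_e_process_def
  by (auto simp: R_nonneg R_measurable intro!: SUP_least nn_integral_value_at_R_le)

section \<open>The threshold time \<open>\<kappa>\<close>\<close>

text \<open>The infimum of a nonempty set in \<open>enat\<close> is attained, and that of the empty
  set is \<open>\<infinity>\<close>.\<close>

lemma kappa_le_iff: "\<kappa> \<alpha> \<omega> \<le> enat T \<longleftrightarrow> (\<exists>t\<in>{1..T}. 1 / \<alpha> \<le> R t \<omega>)"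
proof
  let ?S = "{enat t | t. 1 \<le> t \<and> R t \<omega> \<ge> 1 / \<alpha>}"
  assume le: "\<kappa> \<alpha> \<omega> \<le> enat T"
  have "?S \<noteq> {}"
  proof
    assume "?S = {}"
    then have "\<kappa> \<alpha> \<omega> = \<infinity>" by (simp only: \<kappa>_def Inf_enat_def if_True simp_thms)
    with le show False by simp
  qed
  then have "\<kappa> \<alpha> \<omega> \<in> ?S"
    unfolding \<kappa>_def Inf_enat_def by (simp only: if_False) (metis (no_types, lifting) LeastI ex_in_conv)
  with le show "\<exists>t\<in>{1..T}. 1 / \<alpha> \<le> R t \<omega>" by auto
next
  assume "\<exists>t\<in>{1..T}. 1 / \<alpha> \<le> R t \<omega>"
  then obtain t where "1 \<le> t" "t \<le> T" "1 / \<alpha> \<le> R t \<omega>" by auto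
  then show "\<kappa> \<alpha> \<omega> \<le> enat T"
    unfolding \<kappa>_def by (intro Inf_lower2[of "enat t"]) auto
qed

lemma kappa_le_in_F: "{\<omega>\<in>space seq_space. \<kappa> \<alpha> \<omega> \<le> enat T} \<in> sets (\<F> (enat T))"
proof (rule determined_in_F)
  fix \<omega> \<omega>' assume w: "\<omega> \<in> {\<omega>\<in>space seq_space. \<kappa> \<alpha> \<omega> \<le> enat T}" "\<omega>' \<in> space seq_space"
    and eq: "\<And>s. s \<in> {1..T} \<Longrightarrow> \<omega> s = \<omega>' s"
  have "R t \<omega> = R t \<omega>'" if "t \<le> T" for t
    using that by (intro R_cong eq) auto
  with w show "\<omega>' \<in> {\<omega>\<in>space seq_space. \<kappa> \<alpha> \<omega> \<le> enat T}"
    by (auto simp: kappa_le_iff)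
qed auto

lemma stopping_time_kappa: "stopping_time \<F> (\<kappa> \<alpha>)"
proof
  fix t show "Measurable.pred (\<F> t) (\<lambda>\<omega>. \<kappa> \<alpha> \<omega> \<le> t)"
    using kappa_le_in_F[of \<alpha>] sets.top[of "\<F> \<infinity>"] by (cases t) (simp_all add: pred_def)
qed

lemma kappa_finite_eq:
  "{\<omega>\<in>space seq_space. \<kappa> \<alpha> \<omega> < \<infinity>} = (\<Union>T. {\<omega>\<in>space seq_space. \<kappa> \<alpha> \<omega> \<le> enat T})"
proof -
  have "x < \<infinity> \<longleftrightarrow> (\<exists>T. x \<le> enat T)" for x by (cases x) auto
  then show ?thesis by auto
qed

lemma kappa_le_sets: "{\<omega>\<in>space seq_space. \<kappa> \<alpha> \<omega> \<le> enat T} \<in> sets seq_space"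
  using kappa_le_in_F sets_F_subset by blast

lemma kappa_finite_sets: "{\<omega>\<in>space seq_space. \<kappa> \<alpha> \<omega> < \<infinity>} \<in> sets seq_space"
  unfolding kappa_finite_eq using kappa_le_sets by (intro sets.countable_UN) auto

text \<open>Markov's inequality for \<open>R\<close> stopped at \<open>\<kappa> \<alpha>\<close>,
  where it is at least \<open>1 / \<alpha>\<close> whenever that time is finite.\<close>

lemma bernoulli_law_kappa_le:
  assumes p: "p \<in> {0..1}" and \<alpha>: "0 < \<alpha>"
  shows "emeasure (bernoulli_law p) {\<omega>\<in>space seq_space. \<kappa> \<alpha> \<omega> < \<infinity>} \<le> ennreal \<alpha>" (is "emeasure _ ?A \<le> _")
proof -
  have "ennreal (1 / \<alpha>) * emeasure (bernoulli_law p) ?A = (\<integral>\<^sup>+ \<omega>. ennreal (1 / \<alpha>) * indicator ?A \<omega> \<partial>bernoulli_law p)"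
    using kappa_finite_sets by (intro nn_integral_cmult_indicator[symmetric]) (simp add: sets_bernoulli_law)
  also have "\<dots> \<le> (\<integral>\<^sup>+ \<omega>. value_at R (\<kappa> \<alpha>) \<omega> \<partial>bernoulli_law p)"
  proof (rule nn_integral_mono)
    fix \<omega>
    show "ennreal (1 / \<alpha>) * indicator ?A \<omega> \<le> value_at R (\<kappa> \<alpha>) \<omega>"
    proof (cases "\<kappa> \<alpha> \<omega>")
      case (enat k)
      \<comment> \<open>The level is reached at some \<open>t \<le> k\<close>, and minimality of
        \<open>k\<close> forces \<open>t = k\<close>.\<close>
      then obtain t where t: "t \<in> {1..k}" "1 / \<alpha> \<le> R t \<omega>" using kappa_le_iff[of \<alpha> \<omega> k] by auto
      then have "enat k \<le> enat t" using kappa_le_iff[of \<alpha> \<omega> t] enat by auto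
      with t have "1 / \<alpha> \<le> R k \<omega>" by simp
      then show ?thesis by (auto simp: value_at_def enat indicator_def intro: ennreal_leI)
    qed (simp add: indicator_def)
  qed
  also have "\<dots> \<le> 1" by (rule nn_integral_value_at_R_le[OF p stopping_time_kappa])
  finally have le: "ennreal (1 / \<alpha>) * emeasure (bernoulli_law p) ?A \<le> 1" .
  have "ennreal \<alpha> * ennreal (1 / \<alpha>) = 1" using \<alpha> by (simp add: ennreal_mult[symmetric])
  then have "emeasure (bernoulli_law p) ?A = ennreal \<alpha> * (ennreal (1 / \<alpha>) * emeasure (bernoulli_law p) ?A)"
    by (simp add: mult.assoc[symmetric])
  also have "\<dots> \<le> ennreal \<alpha> * 1" by (intro mult_left_mono le) simp
  finally show ?thesis by simp
qed

section \<open>Exchangeable laws: sampling without and with replacement\<close>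

text \<open>The complements of domain and image in \<open>B\<close> have equal size, so a bijection
  between them completes the injection. This is needed because exchangeability speaks of
  permutations only.\<close>

lemma injection_extends_to_permutation:
  assumes i: "i \<in> A \<rightarrow> B" "inj_on i A" and A: "A \<subseteq> B" "finite B"
  obtains \<sigma> where "\<sigma> permutes B" "\<And>a. a \<in> A \<Longrightarrow> \<sigma> a = i a"
proof -
  have sub: "i ` A \<subseteq> B" using i by auto
  have fin: "finite A" using A finite_subset by blast
  have "card (B - A) = card (B - i ` A)"
    using A sub fin i by (simp add: card_Diff_subset card_image)
  then obtain g where g: "bij_betw g (B - A) (B - i ` A)"
    using A finite_same_card_bij[of "B - A" "B - i ` A"] by auto
  define \<sigma> where "\<sigma> a = (if a \<in> A then i a else if a \<in> B then g a else a)" for a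
  have "bij_betw \<sigma> A (i ` A)"
    using i by (subst bij_betw_cong[of _ _ i]) (auto simp: \<sigma>_def bij_betw_def)
  moreover have "bij_betw \<sigma> (B - A) (B - i ` A)"
    using g by (subst bij_betw_cong[of _ _ g]) (auto simp: \<sigma>_def)
  ultimately have "bij_betw \<sigma> (A \<union> (B - A)) (i ` A \<union> (B - i ` A))"
    by (rule bij_betw_combine) auto
  then have "bij_betw \<sigma> B B" using A sub by (simp add: Un_absorb1)
  then have "\<sigma> permutes B" by (rule bij_imp_permutes) (use A in \<open>auto simp: \<sigma>_def\<close>)
  then show thesis by (rule that) (simp add: \<sigma>_def)
qed

text \<open>The injection is completed to a permutation of \<open>{1..N}\<close>, and
  exchangeability is used at length \<open>N\<close> instead of \<open>T\<close>.\<close>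

lemma exchangeable_injection:
  assumes Q: "Q \<in> exchangeable_laws" and i: "i \<in> {1..T} \<rightarrow> {1..N}" "inj_on i {1..T}" and TN: "T \<le> N"
  shows "emeasure Q (cyl T x) = emeasure Q {\<omega>\<in>space seq_space. \<forall>s\<in>{1..T}. \<omega> (i s) = x s}"
proof -
  have sets: "sets Q = sets seq_space" using Q by (simp add: exchangeable_laws_def)
  then have sp: "space Q = space seq_space" by (rule sets_eq_imp_space_eq)
  let ?P = "PiM {1..N} (\<lambda>_. count_space (UNIV :: bool set))"
  let ?C = "{y\<in>space ?P. \<forall>s\<in>{1..T}. y s = x s}"
  obtain \<sigma> where \<sigma>: "\<sigma> permutes {1..N}" "\<And>s. s \<in> {1..T} \<Longrightarrow> \<sigma> s = i s"
    using injection_extends_to_permutation[OF i] TN by auto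
  have C: "?C \<in> sets ?P"
  proof (rule sets.sets_Collect_finite_All)
    fix s assume "s \<in> {1..T}"
    then have "s \<in> {1..N}" using TN by auto
    from measurable_component_singleton[OF this, of "\<lambda>_. count_space (UNIV :: bool set)"]
    have "(\<lambda>y. y s) -` {x s} \<inter> space ?P \<in> sets ?P" by (rule measurable_sets) simp
    then show "{y\<in>space ?P. y s = x s} \<in> sets ?P"
      by (simp add: vimage_def Int_def conj_commute)
  qed simp
  have meas: "(\<lambda>\<omega>. \<lambda>s\<in>{1..N}. X (\<rho> s) \<omega>) \<in> measurable Q ?P" if "\<rho> permutes {1..N}" for \<rho>
  proof (rule measurable_restrict)
    fix s assume "s \<in> {1..N}"
    then have "\<rho> s \<in> {1..}" using permutes_in_image[OF that, of s] by auto
    then show "X (\<rho> s) \<in> measurable Q (count_space UNIV)"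
      unfolding X_def measurable_cong_sets[OF sets refl] by (rule coord_measurable)
  qed
  have pull: "emeasure (distr Q ?P (\<lambda>\<omega>. \<lambda>s\<in>{1..N}. X (\<rho> s) \<omega>)) ?C =
      emeasure Q {\<omega>\<in>space seq_space. \<forall>s\<in>{1..T}. \<omega> (\<rho> s) = x s}" if \<rho>: "\<rho> permutes {1..N}" for \<rho>
  proof -
    have "(\<lambda>\<omega>. \<lambda>s\<in>{1..N}. X (\<rho> s) \<omega>) -` ?C \<inter> space Q =
        {\<omega>\<in>space seq_space. \<forall>s\<in>{1..T}. \<omega> (\<rho> s) = x s}"
      using TN by (auto simp: sp X_def space_PiM)
    then show ?thesis by (simp only: emeasure_distr[OF meas[OF \<rho>] C])
  qed
  have "distr Q ?P (\<lambda>\<omega>. \<lambda>s\<in>{1..N}. X (id s) \<omega>) = distr Q ?P (\<lambda>\<omega>. \<lambda>s\<in>{1..N}. X (\<sigma> s) \<omega>)"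
    using Q \<sigma>(1) by (simp add: exchangeable_laws_def)
  then have "emeasure Q {\<omega>\<in>space seq_space. \<forall>s\<in>{1..T}. \<omega> (id s) = x s} =
      emeasure Q {\<omega>\<in>space seq_space. \<forall>s\<in>{1..T}. \<omega> (\<sigma> s) = x s}"
    using pull[OF permutes_id] pull[OF \<sigma>(1)] by simp
  then show ?thesis by (simp add: cyl_def \<sigma>(2))
qed

lemma num_eq_card: "num b N \<omega> = card {j\<in>{1..N}. \<omega> j = b}"
  by (simp add: num_def X_def)

text \<open>Both sides count the maps from \<open>{1..T}\<close> to \<open>{1..N}\<close> that read
  the word \<open>x\<close> off \<open>\<omega>\<close>: sampling with replacement is Bernoulli at
  the empirical frequency.\<close>

lemma prod_num_eq_lik: "real (\<Prod>s\<in>{1..T}. num (x s) N \<omega>) = real N ^ T * lik (num True N \<omega> / N) T x"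
proof -
  have "real (num b N \<omega>) = N * (if b then num True N \<omega> / N else 1 - num True N \<omega> / N)" for b
  proof -
    have "real N = num True N \<omega> + num False N \<omega>" using num_add[of N \<omega>] by simp
    then show ?thesis by (cases "N = 0"; cases b) (simp_all add: num_0 right_diff_distrib)
  qed
  then have "real (\<Prod>s\<in>{1..T}. num (x s) N \<omega>) =
      (\<Prod>s\<in>{1..T}. N * (if x s then num True N \<omega> / N else 1 - num True N \<omega> / N))"
    by simp
  also have "\<dots> = real N ^ T * lik (num True N \<omega> / N) T x"
    by (simp only: prod.distrib lik_prod) simp
  finally show ?thesis .
qed

text \<open>Averaging an exchangeable law over all injections \<open>{1..T} \<rightarrow> {1..N}\<close>, and then enlarging the
  sum to all maps, compares sampling without replacement to sampling with replacement from the
  first \<open>N\<close> symbols.\<close>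

lemma exchangeable_cyl_le:
  assumes Q: "Q \<in> exchangeable_laws" and TN: "T \<le> N"
  shows "ennreal (real (N - T) ^ T) * emeasure Q (cyl T x) \<le>
    (\<integral>\<^sup>+ \<omega>. ennreal (real N ^ T * lik (num True N \<omega> / N) T x) \<partial>Q)"
proof -
  have sets: "sets Q = sets seq_space" using Q by (simp add: exchangeable_laws_def)
  define B where "B i = {\<omega>\<in>space seq_space. \<forall>s\<in>{1..T}. \<omega> (i s) = x s}" for i :: "nat \<Rightarrow> nat"
  define I where "I = {i\<in>{1..T} \<rightarrow>\<^sub>E {1..N}. inj_on i {1..T}}"
  have fin: "finite ({1..T} \<rightarrow>\<^sub>E {1..N})" by (intro finite_PiE) auto
  have B: "B i \<in> sets Q" if "i \<in> {1..T} \<rightarrow>\<^sub>E {1..N}" for i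
  proof -
    have "{\<omega>\<in>space seq_space. \<omega> (i s) = x s} \<in> sets seq_space" if "s \<in> {1..T}" for s
    proof -
      have "i s \<in> {1..}" using \<open>i \<in> _\<close> that by (auto simp: PiE_iff)
      then have "(\<lambda>\<omega>. \<omega> (i s)) -` {x s} \<inter> space seq_space \<in> sets seq_space"
        by (intro measurable_sets[OF coord_measurable]) auto
      then show ?thesis by (simp add: vimage_def Int_def conj_commute)
    qed
    then show ?thesis unfolding B_def sets by (intro sets.sets_Collect_finite_All) auto
  qed
  \<comment> \<open>The number of injections is a falling factorial, and each of its
    \<open>T\<close> factors is at least \<open>N - T\<close>.\<close>
  have "(N - T) ^ T \<le> (\<Prod>j\<in>{0..<T}. N - j)"
    using prod_mono[of "{0..<T}" "\<lambda>_. N - T" "\<lambda>j. N - j"] by auto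
  also have "\<dots> = card I"
    unfolding I_def by (subst card_inj_on_subset_funcset) auto
  finally have "ennreal (real (N - T) ^ T) \<le> of_nat (card I)"
    unfolding ennreal_of_nat_eq_real_of_nat by (intro ennreal_leI) (simp flip: of_nat_power)
  then have "ennreal (real (N - T) ^ T) * emeasure Q (cyl T x) \<le> of_nat (card I) * emeasure Q (cyl T x)"
    by (rule mult_right_mono) simp
  also have "\<dots> = (\<Sum>i\<in>I. emeasure Q (cyl T x))" by simp
  also have "\<dots> = (\<Sum>i\<in>I. emeasure Q (B i))"
    unfolding B_def I_def by (intro sum.cong refl exchangeable_injection[OF Q _ _ TN]) auto
  also have "\<dots> \<le> (\<Sum>i\<in>{1..T} \<rightarrow>\<^sub>E {1..N}. emeasure Q (B i))"
    using fin by (intro sum_mono2) (auto simp: I_def)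
  also have "\<dots> = (\<Sum>i\<in>{1..T} \<rightarrow>\<^sub>E {1..N}. \<integral>\<^sup>+ \<omega>. indicator (B i) \<omega> \<partial>Q)"
    using B by (intro sum.cong) auto
  also have "\<dots> = (\<integral>\<^sup>+ \<omega>. (\<Sum>i\<in>{1..T} \<rightarrow>\<^sub>E {1..N}. indicator (B i) \<omega>) \<partial>Q)"
    using B by (intro nn_integral_sum[symmetric]) auto
  also have "\<dots> = (\<integral>\<^sup>+ \<omega>. ennreal (real N ^ T * lik (num True N \<omega> / N) T x) \<partial>Q)"
  proof (rule nn_integral_cong)
    fix \<omega> assume "\<omega> \<in> space Q"
    then have w: "\<omega> \<in> space seq_space" using sets_eq_imp_space_eq[OF sets] by simp
    have "(\<Sum>i\<in>{1..T} \<rightarrow>\<^sub>E {1..N}. indicator (B i) \<omega> :: ennreal) =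
        of_nat (card {i\<in>{1..T} \<rightarrow>\<^sub>E {1..N}. \<omega> \<in> B i})"
      using fin by (simp add: indicator_def sum.If_cases Int_def)
    \<comment> \<open>A map is counted exactly when each \<open>i s\<close> is a position carrying
      the symbol \<open>x s\<close>, so these maps form a product set.\<close>
    also have "{i\<in>{1..T} \<rightarrow>\<^sub>E {1..N}. \<omega> \<in> B i} = (\<Pi>\<^sub>E s\<in>{1..T}. {j\<in>{1..N}. \<omega> j = x s})"
      using w by (simp add: B_def PiE_iff set_eq_iff) blast
    also have "card \<dots> = (\<Prod>s\<in>{1..T}. num (x s) N \<omega>)"
      by (simp add: card_PiE num_eq_card)
    finally show "(\<Sum>i\<in>{1..T} \<rightarrow>\<^sub>E {1..N}. indicator (B i) \<omega>) =
        ennreal (real N ^ T * lik (num True N \<omega> / N) T x)"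
      by (simp only: prod_num_eq_lik[symmetric] ennreal_of_nat_eq_real_of_nat)
  qed
  finally show ?thesis .
qed

text \<open>The dominating mixture draws \<open>\<omega>\<close> from \<open>Q\<close> and uses the
  Bernoulli law at the frequency of its first \<open>N\<close> symbols, so \<open>bound\<close>
  applies inside the integral. As \<open>N\<close> grows, \<open>((N - T) / N) ^ T\<close> tends to
  1.\<close>

lemma exchangeable_le_of_bernoulli_le:
  assumes Q: "Q \<in> exchangeable_laws" and A: "A \<in> sets (\<F> (enat T))" and \<alpha>: "0 \<le> \<alpha>"
    and bound: "\<And>p. p \<in> {0..1} \<Longrightarrow> emeasure (bernoulli_law p) A \<le> ennreal \<alpha>"
  shows "emeasure Q A \<le> ennreal \<alpha>"
proof -
  have sets: "sets Q = sets seq_space" and "prob_space Q"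
    using Q by (auto simp: exchangeable_laws_def)
  then interpret prob_space Q by simp
  have le: "real (N - T) ^ T * measure Q A \<le> real N ^ T * \<alpha>" if TN: "T \<le> N" for N
  proof -
    define L where "L x \<omega> = real N ^ T * lik (num True N \<omega> / N) T x" for x \<omega>
    have frac: "num True N \<omega> / N \<in> {0..1}" for \<omega>
      using num_add[of N \<omega>] by (auto simp: divide_le_eq)
    have L: "(\<lambda>\<omega>. ennreal (L x \<omega>)) \<in> borel_measurable Q" for x
    proof (rule measurable_from_subalg[OF subalgebra_F[OF sets]])
      show "(\<lambda>\<omega>. ennreal (L x \<omega>)) \<in> borel_measurable (\<F> (enat N))"
      proof (rule determined_measurable_F)
        fix \<omega> \<omega>' :: "nat \<Rightarrow> bool" assume "\<And>s. s \<in> {1..N} \<Longrightarrow> \<omega> s = \<omega>' s"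
        then have "num True N \<omega> = num True N \<omega>'" by (rule num_cong)
        then show "ennreal (L x \<omega>) = ennreal (L x \<omega>')" by (simp add: L_def)
      qed simp
    qed
    have "ennreal (real (N - T) ^ T) * emeasure Q A =
        (\<Sum>x\<in>words T. indicator A x * (ennreal (real (N - T) ^ T) * emeasure Q (cyl T x)))"
      unfolding emeasure_words[OF sets A] by (simp add: sum_distrib_left mult_ac)
    also have "\<dots> \<le> (\<Sum>x\<in>words T. indicator A x * (\<integral>\<^sup>+ \<omega>. ennreal (L x \<omega>) \<partial>Q))"
      unfolding L_def by (intro sum_mono mult_left_mono exchangeable_cyl_le[OF Q TN]) simp
    also have "\<dots> = (\<integral>\<^sup>+ \<omega>. (\<Sum>x\<in>words T. indicator A x * ennreal (L x \<omega>)) \<partial>Q)"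
      using L by (simp add: nn_integral_sum nn_integral_cmult)
    also have "\<dots> \<le> (\<integral>\<^sup>+ \<omega>. ennreal (real N ^ T * \<alpha>) \<partial>Q)"
    proof (rule nn_integral_mono)
      fix \<omega>
      \<comment> \<open>For fixed \<open>\<omega>\<close> the words in \<open>A\<close> reassemble
        into the probability of \<open>A\<close> under a single Bernoulli law.\<close>
      have "(\<Sum>x\<in>words T. indicator A x * ennreal (L x \<omega>)) =
          ennreal (real N ^ T) * emeasure (bernoulli_law (num True N \<omega> / N)) A"
        unfolding emeasure_words[OF sets_bernoulli_law A] emeasure_bernoulli_law_cyl[OF frac] L_def
        using frac by (simp add: sum_distrib_left ennreal_mult lik_nonneg mult_ac del: sum_ennreal)
      also have "\<dots> \<le> ennreal (real N ^ T) * ennreal \<alpha>"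
        by (intro mult_left_mono bound frac) simp
      also have "\<dots> = ennreal (real N ^ T * \<alpha>)" using \<alpha> by (simp add: ennreal_mult)
      finally show "(\<Sum>x\<in>words T. indicator A x * ennreal (L x \<omega>)) \<le> ennreal (real N ^ T * \<alpha>)" .
    qed
    also have "\<dots> = ennreal (real N ^ T * \<alpha>)" by (simp add: emeasure_space_1)
    finally show ?thesis using \<alpha> by (simp add: emeasure_eq_measure flip: ennreal_mult)
  qed
  have "measure Q A \<le> \<alpha>"
  proof (rule LIMSEQ_le_const2)
    have "(\<lambda>N. (1 - real T * inverse (real N)) ^ T * measure Q A) \<longlonglongrightarrow> (1 - real T * 0) ^ T * measure Q A"
      by (intro tendsto_intros lim_inverse_n)
    then show "(\<lambda>N. (1 - real T / real N) ^ T * measure Q A) \<longlonglongrightarrow> measure Q A"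
      by (simp add: divide_inverse)
    show "\<exists>M. \<forall>N\<ge>M. (1 - real T / real N) ^ T * measure Q A \<le> \<alpha>"
    \<comment> \<open>\<open>Suc T\<close> secures both \<open>T \<le> N\<close> and
      \<open>N > 0\<close>, as the subtraction and the division by \<open>N\<close> demand.\<close>
    proof (intro exI[of _ "Suc T"] allI impI)
      fix N assume N: "Suc T \<le> N"
      have "1 - real T / real N = real (N - T) / real N" using N by (simp add: of_nat_diff field_simps)
      then show "(1 - real T / real N) ^ T * measure Q A \<le> \<alpha>"
        using le[of N] N by (simp add: power_divide field_simps)
    qed
  qed
  then show ?thesis by (simp add: emeasure_eq_measure ennreal_leI)
qed

text \<open>The comparison with Bernoulli laws works at a finite horizon, so the event that
  \<open>\<kappa> \<alpha>\<close> is finite is exhausted by the increasing events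
  \<open>A T\<close>.\<close>

lemma exchangeable_kappa_le:
  assumes Q: "Q \<in> exchangeable_laws" and \<alpha>: "0 < \<alpha>"
  shows "emeasure Q {\<omega>\<in>space Q. \<kappa> \<alpha> \<omega> < \<infinity>} \<le> ennreal \<alpha>"
proof -
  have sets: "sets Q = sets seq_space" using Q by (simp add: exchangeable_laws_def)
  define A where "A T = {\<omega>\<in>space seq_space. \<kappa> \<alpha> \<omega> \<le> enat T}" for T
  have "emeasure Q (A T) \<le> ennreal \<alpha>" for T
  proof (rule exchangeable_le_of_bernoulli_le[OF Q])
    show "A T \<in> sets (\<F> (enat T))" unfolding A_def by (rule kappa_le_in_F)
    fix p :: real assume p: "p \<in> {0..1}"
    have "emeasure (bernoulli_law p) (A T) \<le> emeasure (bernoulli_law p) {\<omega>\<in>space seq_space. \<kappa> \<alpha> \<omega> < \<infinity>}"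
      using kappa_finite_sets unfolding kappa_finite_eq A_def
      by (intro emeasure_mono) (auto simp: sets_bernoulli_law)
    also note bernoulli_law_kappa_le[OF p \<alpha>]
    finally show "emeasure (bernoulli_law p) (A T) \<le> ennreal \<alpha>" .
  qed (use \<alpha> in simp)
  moreover have "range A \<subseteq> sets Q" unfolding A_def sets using kappa_le_sets by auto
  moreover have "incseq A" by (rule incseq_SucI) (auto simp: A_def intro: order_trans)
  ultimately have "emeasure Q (\<Union>T. A T) \<le> ennreal \<alpha>"
    by (subst SUP_emeasure_incseq[symmetric]) (auto intro!: SUP_least)
  then show ?thesis
    unfolding sets_eq_imp_space_eq[OF sets] kappa_finite_eq A_def .
qed

theorem theorem6:
  shows "safe_e_process {bernoulli_law p | p. p \<in> {0..1}} R \<and>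
    (\<forall>\<alpha>\<in>{0<..<1}.
       (SUP Q\<in>exchangeable_laws. emeasure Q {\<omega>\<in>space Q. \<kappa> \<alpha> \<omega> < \<infinity>}) \<le> ennreal \<alpha>)"
  by (intro conjI ballI SUP_least safe_e_process_R exchangeable_kappa_le) auto

end
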